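(* Let $U(r)=r\log r$ (linear diffusion). Let $W\colon\mathbb{R}^d\to(-\infty,\infty]$ be positive, locally integrable, lower semicontinuous and symmetric ($W(x)=W(-x)$ for all $x\in\mathbb{R}^d$), and suppose that $W\in L^\infty(\mathbb{R}^d\setminus B_\delta)$ for every $\delta>0$, where $B_\delta$ is the open ball of radius $\delta$ centered at the origin. Then for every $\varepsilon>0$ the energy $E_\varepsilon=\varepsilon\mathcal{E}+\mathcal{W}$ does not admit any $d_p$-local minimizer, for any $p\in[1,\infty]$, in $\mathcal{P}(\mathbb{R}^d)$. Moreover, if $W$ is Lipschitz continuous, then there are no critical points of $E_\varepsilon$ in $\mathcal{P}_{\mathrm{ac}}(\mathbb{R}^d)$.
   Context: $\mathcal{P}(\mathbb{R}^d)$ is the set of Borel probability measures on $\mathbb{R}^d$ and $\mathcal{P}_{\mathrm{ac}}(\mathbb{R}^d)$ the subset of those absolutely continuous with respect to Lebesgue measure (a measure and its density are denoted by the same symbol). $\mathcal{P}_p(\mathbb{R}^d)$ is the set of probability measures with finite $p$th moment. Energy: for $\rho\in\mathcal{P}(\mathbb{R}^d)$, $$\mathcal{W}(\rho)=\frac12\int_{\mathbb{R}^d}\int_{\mathbb{R}^d}W(x-y)\,d\rho(x)\,d\rho(y),\qquad \mathcal{E}(\rho)=\begin{cases}\int_{\mathbb{R}^d}\rho(x)\log\rho(x)\,dx&\text{if }\rho\in\mathcal{P}_{\mathrm{ac}}(\mathbb{R}^d),\\+\infty&\text{otherwise},\end{cases}$$ and $E_\varepsilon(\rho)=\mathcal{W}(\rho)+\varepsilon\mathcal{E}(\rho)$,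 regarded as taking values in $(-\infty,\infty]$. Wasserstein distances: $\Pi(\mu,\nu)$ is the set of transport plans (probability measures on $\mathbb{R}^d\times\mathbb{R}^d$ with first marginal $\mu$ and second marginal $\nu$). For $p\in[1,\infty)$ and $\mu,\nu\in\mathcal{P}_p(\mathbb{R}^d)$, $d_p(\mu,\nu)=\min_{\pi\in\Pi(\mu,\nu)}\left(\int|x-y|^p\,d\pi(x,y)\right)^{1/p}$. For compactly supported $\mu,\nu$, $d_\infty(\mu,\nu)=\inf_{\pi\in\Pi(\mu,\nu)}\sup_{(x,y)\in\operatorname{supp}\pi}|x-y|$. Local minimizers: $\rho$ (in the class on which $d_p$ is defined) is a $d_p$-local minimizer of $E_\varepsilon$ if there is $r>0$ such that $E_\varepsilon(\rho)\le E_\varepsilon(\nu)$ for every probability measure $\nu$ (in the same class) with $d_p(\rho,\nu)<r$. Critical points: $\rho$ is a critical point of $E_\varepsilon$ if $E_\varepsilon(\rho)<\infty$ and $\varepsilon U'(\rho)+W*\rho$ (equivalently, up to an additive constant, $\varepsilon\log\rho+W*\rho$) is equal to a constant, possibly different in each closed connected component of the support of $\rho$.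
   Formalization: In "critical point" the condition is required at every point of the support, with real constants and with the density taken as the limit of ball averages (0 if none); read a.e. the claim fails, e.g. for Gaussian W and the minimizer of the energy among measures on [0,1]. *)

theory Defs
  imports "HOL-Probability.Probability"
begin

definition lower_semicontinuous :: "('a::topological_space \<Rightarrow> ereal) \<Rightarrow> bool" where
  "lower_semicontinuous f \<longleftrightarrow> (\<forall>x a. a < f x \<longrightarrow> (\<forall>\<^sub>F y in nhds x. a < f y))"

definition locally_integrable :: "('a::euclidean_space \<Rightarrow> ereal) \<Rightarrow> bool" where
  "locally_integrable f \<longleftrightarrow> f \<in> borel_measurable borel \<and>
     (\<forall>K. compact K \<longrightarrow> (\<integral>\<^sup>+x\<in>K. e2ennreal \<bar>f x\<bar> \<partial>lborel) < \<infinity>)"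

definition Linfty_on :: "'a::euclidean_space set \<Rightarrow> ('a \<Rightarrow> ereal) \<Rightarrow> bool" where
  "Linfty_on S f \<longleftrightarrow> f \<in> borel_measurable borel \<and>
     (\<exists>M::real. AE x in lborel. x \<in> S \<longrightarrow> \<bar>f x\<bar> \<le> ereal M)"

text \<open>
  Integral of an extended-real function as the integral of its positive part minus that of its
  negative part (\<open>e2ennreal\<close> sends negative numbers to 0). In type \<open>ereal\<close> one has
  \<open>\<infinity> - \<infinity> = \<infinity>\<close>, so an undefined integral gets the value \<open>\<infinity>\<close>.
\<close>

definition ext_integral :: "'a measure \<Rightarrow> ('a \<Rightarrow> ereal) \<Rightarrow> ereal" where
  "ext_integral M f =
     enn2ereal (\<integral>\<^sup>+x. e2ennreal (f x) \<partial>M) - enn2ereal (\<integral>\<^sup>+x. e2ennreal (- f x) \<partial>M)"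

definition borel_prob :: "'a::topological_space measure set" where
  "borel_prob = {\<mu>. prob_space \<mu> \<and> sets \<mu> = sets borel}"

definition borel_prob_ac :: "'a::euclidean_space measure set" where
  "borel_prob_ac = {\<mu> \<in> borel_prob. absolutely_continuous lborel \<mu>}"

definition msupport :: "'a::topological_space measure \<Rightarrow> 'a set" where
  "msupport \<mu> = {x. \<forall>U. open U \<longrightarrow> x \<in> U \<longrightarrow> emeasure \<mu> U > 0}"


definition interaction_energy :: "('a::euclidean_space \<Rightarrow> ereal) \<Rightarrow> 'a measure \<Rightarrow> ereal" where
  "interaction_energy W \<rho> =
     ereal (1/2) * ext_integral \<rho> (\<lambda>y. ext_integral \<rho> (\<lambda>x. W (x - y)))"

text \<open>The value at \<open>r = 0\<close> is 0, since \<open>0 * ln 0 = 0\<close>.\<close>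

definition U_lin :: "real \<Rightarrow> real" where
  "U_lin r = r * ln r"

definition internal_energy :: "'a::euclidean_space measure \<Rightarrow> ereal" where
  "internal_energy \<rho> =
     (if \<rho> \<in> borel_prob_ac
      then ext_integral lborel (\<lambda>x. ereal (U_lin (enn2real (RN_deriv lborel \<rho> x))))
      else \<infinity>)"

definition energy :: "('a::euclidean_space \<Rightarrow> ereal) \<Rightarrow> real \<Rightarrow> 'a measure \<Rightarrow> ereal" where
  "energy W \<epsilon> \<rho> = interaction_energy W \<rho> + ereal \<epsilon> * internal_energy \<rho>"


definition transport_plans ::
    "'a::euclidean_space measure \<Rightarrow> 'a measure \<Rightarrow> ('a \<times> 'a) measure set" where
  "transport_plans \<mu> \<nu> =
     {\<pi> \<in> borel_prob. distr \<pi> borel fst = \<mu> \<and> distr \<pi> borel snd = \<nu>}"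

text \<open>The class on which the Wasserstein distance of order \<open>p\<close> is considered.\<close>

definition wasserstein_class :: "ereal \<Rightarrow> 'a::euclidean_space measure set" where
  "wasserstein_class p =
     {\<mu> \<in> borel_prob.
        if p = \<infinity> then compact (msupport \<mu>)
        else (\<integral>\<^sup>+x. ennreal (norm x powr real_of_ereal p) \<partial>\<mu>) < \<infinity>}"

text \<open>
  For \<open>p < \<infinity>\<close> the infimum is finite on \<open>wasserstein_class p\<close> (take the product plan), so
  \<open>enn2real\<close> loses nothing there.
\<close>

definition wasserstein ::
    "ereal \<Rightarrow> 'a::euclidean_space measure \<Rightarrow> 'a measure \<Rightarrow> ennreal" where
  "wasserstein p \<mu> \<nu> =
     (if p = \<infinity>
      then (INF \<pi>\<in>transport_plans \<mu> \<nu>. SUP (x, y)\<in>msupport \<pi>. ennreal (norm (x - y)))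
      else ennreal
        (enn2real (INF \<pi>\<in>transport_plans \<mu> \<nu>.
           \<integral>\<^sup>+(x, y). ennreal (norm (x - y) powr real_of_ereal p) \<partial>\<pi>)
         powr (1 / real_of_ereal p)))"

definition local_minimizer ::
    "ereal \<Rightarrow> ('a::euclidean_space \<Rightarrow> ereal) \<Rightarrow> real \<Rightarrow> 'a measure \<Rightarrow> bool" where
  "local_minimizer p W \<epsilon> \<rho> \<longleftrightarrow> \<rho> \<in> wasserstein_class p \<and>
     (\<exists>r::real. r > 0 \<and> (\<forall>\<nu>\<in>wasserstein_class p.
        wasserstein p \<rho> \<nu> < ennreal r \<longrightarrow> energy W \<epsilon> \<rho> \<le> energy W \<epsilon> \<nu>))"


text \<open>
  The condition defining critical points evaluates the density of \<open>\<rho>\<close> at every point of the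
  support, whereas a density is determined only almost everywhere. It is read with the precise
  representative: the limit of the averages of \<open>\<rho>\<close> over shrinking balls, and 0 where there is
  no finite limit. By Lebesgue differentiation it is a density of \<open>\<rho>\<close>, and it is the
  continuous one if there is a continuous density.

  An almost-everywhere reading would be too weak: the normalized Lebesgue measure on a totally
  disconnected compact set that is the support of its own Lebesgue measure would be critical for
  every \<open>W\<close>, and so would be any minimizer of the energy among the probability
  measures on a fixed closed ball, for bounded Lipschitz \<open>W\<close>.
\<close>

definition precise_density :: "'a::euclidean_space measure \<Rightarrow> 'a \<Rightarrow> real" where
  "precise_density \<rho> x =
     (let avg = (\<lambda>r. measure \<rho> (ball x r) / measure lborel (ball x r))
      in if \<exists>l. (avg \<longlongrightarrow> l) (at_right 0) then Lim (at_right 0) avg else 0)"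

text \<open>Derivative of \<open>U_lin\<close>, with its limit \<open>-\<infinity>\<close> at 0.\<close>

definition U_lin' :: "real \<Rightarrow> ereal" where
  "U_lin' r = (if r = 0 then -\<infinity> else ereal (ln r + 1))"

definition conv :: "('a::euclidean_space \<Rightarrow> ereal) \<Rightarrow> 'a measure \<Rightarrow> 'a \<Rightarrow> ereal" where
  "conv W \<rho> x = ext_integral \<rho> (\<lambda>y. W (x - y))"

text \<open>
  The constants are real numbers, so a critical point has a positive density on its
  support. The components of a closed set are closed.
\<close>

definition critical_point ::
    "('a::euclidean_space \<Rightarrow> ereal) \<Rightarrow> real \<Rightarrow> 'a measure \<Rightarrow> bool" where
  "critical_point W \<epsilon> \<rho> \<longleftrightarrow> energy W \<epsilon> \<rho> < \<infinity> \<and>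
     (\<forall>C\<in>components (msupport \<rho>). \<exists>c::real. \<forall>x\<in>C.
        ereal \<epsilon> * U_lin' (precise_density \<rho> x) + conv W \<rho> x = ereal c)"

end

theory Submission
  imports Defs
begin

text \<open>
  Local minimizers. Mollifying at a small scale produces a competitor of finite energy, so a local
  minimizer \<open>\<rho>\<close> has finite energy; as its first moment is finite, its entropy is finite too. Now
  move a small fraction \<open>t\<close> of the mass \<open>m\<close> of a set \<open>A\<close> to a ball \<open>B\<close> that carries almost no mass
  of \<open>\<rho>\<close>. The interaction energy grows by at most \<open>t m K\<close>, with \<open>K\<close> independent of the position of
  \<open>B\<close>, whereas the entropy changes by at most \<open>t (m ln s + C)\<close>, where \<open>s\<close> is the new mean density
  on \<open>B\<close>; this wins for small \<open>s\<close>. For \<open>p < \<infinity>\<close> take \<open>A\<close> the whole space and \<open>B\<close> a unit ball far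
  away. For \<open>p = \<infinity>\<close> take \<open>A\<close> a small ball around an extreme point of the compact support, and \<open>B\<close>
  a ball just outside the support.

  Critical points. On the support \<open>S\<close> the precise density \<open>D\<close> is positive, and \<open>ln D\<close> is Lipschitz
  on every component of \<open>S\<close> with one and the same constant. If \<open>S\<close> had frontier points, Baire's
  theorem on the frontier would give a frontier portion on which \<open>D\<close> varies by a factor close to 1,
  and by the Lipschitz bound the same would hold on \<open>S\<close> near that portion. But a point of \<open>S\<close> nearest to a point outside
  \<open>S\<close> is touched by a ball in the complement, so the mean density of \<open>\<rho>\<close> there is too small.
  Hence \<open>S\<close> is the whole space, \<open>D\<close> is bounded below by a positive constant because \<open>W * \<rho>\<close> is
  bounded, and \<open>\<rho>\<close> would have infinite mass.
\<close>

section \<open>Comparison of measures on balls\<close>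

lemma negligible_null_lborel:
  assumes "negligible N" "N \<in> sets borel"
  shows "N \<in> null_sets lborel"
  using assms by (simp add: negligible_iff_null_sets null_sets_completion_iff)

text \<open>Vitali's theorem selects countably many disjoint good balls that exhaust
  \<open>G\<close> up to a Lebesgue null set. Absolute continuity of \<open>\<mu>\<close> discards
  the remainder, and the balls are compared one by one. This turns pointwise bounds on limits of
  ball averages into bounds on measures, from above and from below.\<close>

lemma Vitali_comparison:
  fixes \<mu> \<nu> :: "'a::euclidean_space measure"
  assumes [measurable_cong]: "sets \<mu> = sets borel" "sets \<nu> = sets borel"
    and ac: "absolutely_continuous lborel \<mu>"
    and G: "open G"
    and small: "\<And>x d. x \<in> G \<Longrightarrow> d > 0 \<Longrightarrow>
      \<exists>r. 0 < r \<and> r < d \<and> ball x r \<subseteq> G \<and> emeasure \<mu> (ball x r) \<le> emeasure \<nu> (ball x r)"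
  shows "emeasure \<mu> G \<le> emeasure \<nu> G"
proof -
  define K where "K = {(x, r). x \<in> G \<and> 0 < r \<and> ball x r \<subseteq> G \<and>
    emeasure \<mu> (ball x r) \<le> emeasure \<nu> (ball x r)}"
  define X where "X = (\<lambda>i::'a \<times> real. ball (fst i) (snd i))"
  have "\<exists>i. i \<in> K \<and> x \<in> ball (fst i) (snd i) \<and> snd i < d" if "x \<in> G" "0 < d" for x d
    using small[OF that] that by (force simp: K_def)
  then obtain C where C: "countable C" "C \<subseteq> K"
      "pairwise (\<lambda>i j. disjnt (X i) (X j)) C"
      "negligible (G - (\<Union>i\<in>C. X i))"
    unfolding X_def by (rule Vitali_covering_theorem_balls[of G K fst snd])
  have X: "X i \<in> sets borel" for i by (simp add: X_def)
  have UX: "(\<Union>i\<in>C. X i) \<in> sets borel" by (intro borel_open open_UN) (simp add: X_def)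
  have XG: "X i \<subseteq> G" if "i \<in> C" for i
    using subsetD[OF C(2) that] by (auto simp: K_def X_def split: prod.splits)
  have dj: "disjoint_family_on X C"
    using C(3) by (auto simp: disjoint_family_on_def pairwise_def disjnt_def)
  have "G - (\<Union>i\<in>C. X i) \<in> null_sets \<mu>"
    using negligible_null_lborel[OF C(4)] ac G UX by (auto simp: absolutely_continuous_def)
  moreover have "G \<subseteq> (\<Union>i\<in>C. X i) \<union> (G - (\<Union>i\<in>C. X i))" by auto
  ultimately have "emeasure \<mu> G \<le> emeasure \<mu> (\<Union>i\<in>C. X i)"
    using UX G assms(1)
    by (metis emeasure_Un_null_set emeasure_mono sets.Un null_setsD2)
  also have "\<dots> = (\<integral>\<^sup>+i. emeasure \<mu> (X i) \<partial>count_space C)"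
    using dj C(1) X by (intro emeasure_UN_countable) (simp_all add: assms(1))
  also have "\<dots> \<le> (\<integral>\<^sup>+i. emeasure \<nu> (X i) \<partial>count_space C)"
    using C(2) by (intro nn_integral_mono) (auto simp: K_def X_def)
  also have "\<dots> = emeasure \<nu> (\<Union>i\<in>C. X i)"
    using dj C(1) X by (intro emeasure_UN_countable[symmetric]) (simp_all add: assms(2))
  also have "\<dots> \<le> emeasure \<nu> G"
    using XG G by (intro emeasure_mono) (auto simp: assms(2))
  finally show ?thesis .
qed

text \<open>If no \<open>E i\<close> contained a relative ball of \<open>F\<close>, every
  \<open>F - E i\<close> would be relatively open and dense in \<open>F\<close>. By Baire their
  intersection would be dense, but it is empty because the \<open>E i\<close> cover
  \<open>F\<close>.\<close>

lemma Baire_closed_cover: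
  fixes F :: "'a::{real_normed_vector,heine_borel} set"
  assumes F: "closed F" "F \<noteq> {}" and I: "countable I"
    and E: "\<And>i. i \<in> I \<Longrightarrow> closed (E i)" "F \<subseteq> (\<Union>i\<in>I. E i)"
  obtains i x \<delta> where "i \<in> I" "x \<in> F" "\<delta> > 0" "F \<inter> ball x \<delta> \<subseteq> E i"
proof (rule ccontr)
  assume "\<not> thesis"
  with that have no: "\<not> F \<inter> ball x \<delta> \<subseteq> E i" if "i \<in> I" "x \<in> F" "\<delta> > 0" for i x \<delta>
    using that by blast
  have "F \<subseteq> closure (\<Inter>((\<lambda>i. F - E i) ` I))"
  proof (rule Baire)
    fix T assume "T \<in> (\<lambda>i. F - E i) ` I"
    then obtain i where i: "i \<in> I" "T = F - E i" by auto
    have "openin (top_of_set F) (F \<inter> - E i)"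
      using E(1)[OF i(1)] by (intro openin_open_Int) auto
    then have "openin (top_of_set F) T" by (simp add: i Diff_eq)
    moreover have "x \<in> closure T" if "x \<in> F" for x
      unfolding closure_approachable
    proof (intro allI impI)
      fix e :: real assume "0 < e"
      from no[OF i(1) that this] show "\<exists>y\<in>T. dist y x < e"
        by (auto simp: i dist_commute)
    qed
    ultimately show "openin (top_of_set F) T \<and> F \<subseteq> closure T" by blast
  qed (use F I in auto)
  moreover have "\<Inter>((\<lambda>i. F - E i) ` I) = {}" using E(2) F(2) by blast
  ultimately show False using F by simp
qed

text \<open>Spheres are null sets of \<open>\<rho>\<close>, so the indicators of the moving balls
  converge almost everywhere and dominated convergence applies. The continuity makes the sets in the
  Baire argument closed.\<close>

lemma continuous_measure_ball:
  fixes \<rho> :: "'a::euclidean_space measure"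
  assumes \<rho>: "\<rho> \<in> borel_prob_ac"
  shows "continuous_on UNIV (\<lambda>x. measure \<rho> (ball x r))"
proof (rule continuous_on_sequentiallyI)
  interpret prob_space \<rho> using \<rho> by (auto simp: borel_prob_ac_def borel_prob_def)
  have [measurable_cong]: "sets \<rho> = sets borel"
    using \<rho> by (auto simp: borel_prob_ac_def borel_prob_def)
  fix u :: "nat \<Rightarrow> 'a" and x assume u: "u \<longlonglongrightarrow> x"
  have "sphere x r \<in> null_sets lborel"
    by (rule negligible_null_lborel) (auto simp: negligible_sphere)
  then have "sphere x r \<in> null_sets \<rho>"
    using \<rho> by (auto simp: borel_prob_ac_def absolutely_continuous_def)
  then have AE: "AE y in \<rho>. y \<notin> sphere x r" by (rule AE_not_in)
  have "(\<lambda>n. \<integral>y. indicator (ball (u n) r) y \<partial>\<rho>) \<longlonglongrightarrow> (\<integral>y. indicator (ball x r) y \<partial>\<rho> :: real)"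
  proof (rule integral_dominated_convergence[where w = "\<lambda>_. 1"])
    show "AE y in \<rho>. (\<lambda>n. indicator (ball (u n) r) y :: real) \<longlonglongrightarrow> indicator (ball x r) y"
      using AE
    proof eventually_elim
      fix y assume y: "y \<notin> sphere x r"
      have lim: "(\<lambda>n. dist (u n) y) \<longlonglongrightarrow> dist x y" by (intro tendsto_intros u)
      consider "dist x y < r" | "r < dist x y" using y by fastforce
      then have "\<forall>\<^sub>F n in sequentially. (dist (u n) y < r) = (dist x y < r)"
      proof cases
        case 1
        from order_tendstoD(2)[OF lim 1] show ?thesis by eventually_elim (use 1 in auto)
      next
        case 2
        from order_tendstoD(1)[OF lim 2] show ?thesis by eventually_elim (use 2 in auto)
      qed
      then show "(\<lambda>n. indicator (ball (u n) r) y :: real) \<longlonglongrightarrow> indicator (ball x r) y"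
        by (intro tendsto_eventually, elim eventually_mono) (auto simp: indicator_def)
    qed
  qed (auto simp: indicator_def)
  then show "(\<lambda>n. measure \<rho> (ball (u n) r)) \<longlonglongrightarrow> measure \<rho> (ball x r)"
    by simp
qed

section \<open>The support of a critical point\<close>

lemma closed_msupport: "closed (msupport \<mu>)"
  unfolding closed_def open_subopen[of "- msupport \<mu>"]
  by (fastforce simp: msupport_def)

text \<open>The complement of the support is the union of all open null sets; by Lindelof countably
  many of them suffice.\<close>

lemma emeasure_Compl_msupport:
  fixes \<mu> :: "'a::second_countable_topology measure"
  assumes "sets \<mu> = sets borel"
  shows "- msupport \<mu> \<in> null_sets \<mu>"
proof -
  define \<U> where "\<U> = {U. open U \<and> emeasure \<mu> U = 0}"
  have "\<And>U. U \<in> \<U> \<Longrightarrow> open U" by (simp add: \<U>_def)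
  then obtain \<V> where \<V>: "\<V> \<subseteq> \<U>" "countable \<V>" "\<Union>\<V> = \<Union>\<U>" by (rule Lindelof)
  have "(\<Union>U\<in>\<V>. U) \<in> null_sets \<mu>"
    using \<V> by (intro null_sets_UN') (auto simp: null_sets_def assms \<U>_def)
  moreover have "- msupport \<mu> = \<Union>\<U>" by (auto simp: msupport_def \<U>_def)
  ultimately show ?thesis using \<V> by simp
qed

lemma msupport_subset:
  assumes "closed K" "emeasure \<mu> (- K) = 0"
  shows "msupport \<mu> \<subseteq> K"
  using assms by (force simp: msupport_def open_Compl)

lemma content_ball_0:
  fixes x :: "'a::euclidean_space"
  shows "measure lborel (ball x r) = measure lborel (ball (0::'a) r)"
  by (cases "r \<ge> 0") (simp_all add: content_ball ball_empty)

lemma emeasure_lborel_ball: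
  fixes x :: "'a::euclidean_space"
  shows "emeasure lborel (ball x r) = ennreal (measure lborel (ball (0::'a) r))"
  using emeasure_eq_ennreal_measure[of lborel "ball x r"] emeasure_lborel_ball_finite[of x r]
  by (simp add: content_ball_0[of x] less_top[symmetric])

text \<open>Take \<open>y\<close> nearest to \<open>x\<close> on the frontier. The open ball around
  \<open>x\<close> that reaches to \<open>y\<close> does not meet the frontier, so by connectedness
  it lies in \<open>S\<close>. Its closure is a connected subset of \<open>S\<close> joining
  \<open>x\<close> to \<open>y\<close>. Estimates known only within components can thus be carried
  from the frontier to nearby points of \<open>S\<close>.\<close>

lemma obtain_frontier_same_component:
  fixes S :: "'a::euclidean_space set"
  assumes S: "closed S" "x \<in> S" and z: "z \<in> frontier S"
  obtains y C where "y \<in> frontier S" "C \<in> components S" "x \<in> C" "y \<in> C" "dist x y \<le> dist x z"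
proof -
  obtain y where y: "y \<in> frontier S" "\<And>u. u \<in> frontier S \<Longrightarrow> dist x y \<le> dist x u"
    using distance_attains_inf[of "frontier S" x] z by auto
  have "cball x (dist x y) \<subseteq> S"
  proof (cases "x = y")
    case True
    with S show ?thesis by simp
  next
    case False
    have "ball x (dist x y) \<subseteq> S"
    proof (rule ccontr)
      assume "\<not> ball x (dist x y) \<subseteq> S"
      then have "ball x (dist x y) \<inter> frontier S \<noteq> {}"
        using S False by (intro connected_Int_frontier) (auto simp: disjoint_iff intro!: bexI[of _ x])
      with y(2) show False by (fastforce simp: disjoint_iff)
    qed
    then have "closure (ball x (dist x y)) \<subseteq> S" using S by (simp add: closure_minimal)
    then show ?thesis using False by simp
  qed
  then have "y \<in> connected_component_set S x"
    by (auto simp: connected_component_def intro!: exI[of _ "cball x (dist x y)"])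
  with S z show ?thesis
    by (intro that[of y "connected_component_set S x"] y) (auto simp: components_def)
qed

lemma content_ball_quarter:
  assumes "r > 0"
  shows "measure lborel (cball (x::'a::euclidean_space) (r / 4)) = (1/4) ^ DIM('a) * measure lborel (ball (0::'a) r)"
  using assms by (simp add: content_cball content_ball power_divide)

text \<open>
  The set \<open>- S\<close> contains a ball touching the frontier of \<open>S\<close> at \<open>y\<close>, so near \<open>y\<close> the support
  misses a fixed fraction of every small ball.
\<close>

lemma obtain_exterior_ball:
  fixes S :: "'a::euclidean_space set"
  assumes S: "closed S" and x: "x \<in> frontier S" and \<delta>: "\<delta> > 0"
  obtains y R where "y \<in> frontier S" "dist x y < \<delta>" "R > 0"
    "\<And>r. 0 < r \<Longrightarrow> r < R \<Longrightarrow> \<exists>c. cball c (r / 4) \<subseteq> ball y r - S"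
proof -
  have "x \<in> closure (- S)" using x by (simp add: frontier_closures)
  \<comment> \<open>The nearest point \<open>y\<close> of \<open>S\<close> to \<open>z\<close> is no
    farther from \<open>z\<close> than \<open>x\<close> is, so halving \<open>\<delta>\<close> here
    gives \<open>dist x y < \<delta>\<close> below.\<close>
  then obtain z where z: "z \<notin> S" "dist z x < \<delta> / 2"
    using \<delta> by (auto simp: closure_approachable dest: spec[of _ "\<delta> / 2"])
  have xS: "x \<in> S" using x S frontier_subset_closed by blast
  obtain y where y: "y \<in> S" "\<And>u. u \<in> S \<Longrightarrow> dist z y \<le> dist z u"
    using distance_attains_inf[of S z] S xS by auto
  define R where "R = dist z y"
  have R: "R > 0" using y z by (auto simp: R_def)
  \<comment> \<open>The centre lies at distance \<open>r / 2\<close> from \<open>y\<close> on the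
    segment towards \<open>z\<close>. A ball of radius \<open>r / 4\<close> around it stays inside
    both \<open>ball y r\<close> and \<open>ball z R\<close>, and the latter misses
    \<open>S\<close>.\<close>
  have *: "cball (y + (r / (2 * R)) *\<^sub>R (z - y)) (r / 4) \<subseteq> ball y r - S" if r: "0 < r" "r < R" for r
  proof
    let ?c = "y + (r / (2 * R)) *\<^sub>R (z - y)"
    fix u assume u: "u \<in> cball ?c (r / 4)"
    have "dist y ?c = norm ((r / (2 * R)) *\<^sub>R (z - y))" by (simp only: dist_norm norm_minus_commute) simp
    also have "\<dots> = r / 2" using r R by (simp add: R_def dist_norm)
    finally have "dist y ?c = r / 2" .
    then have yu: "dist y u < r" using u r dist_triangle[of y u ?c] by simp
    have "z - ?c = (1 - r / (2 * R)) *\<^sub>R (z - y)" by (simp add: algebra_simps)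
    then have "dist z ?c = \<bar>1 - r / (2 * R)\<bar> * R" by (simp add: dist_norm R_def)
    also have "\<dots> = R - r / 2" using r R by (simp add: field_simps abs_if)
    finally have "dist z u < R" using u r dist_triangle[of z u ?c] by simp
    with yu y(2)[of u] show "u \<in> ball y r - S" by (auto simp: R_def)
  qed
  have "y \<notin> interior S"
  proof
    assume "y \<in> interior S"
    then obtain e where e: "e > 0" "ball y e \<subseteq> S" by (auto simp: mem_interior)
    define r where "r = min (e / 2) (R / 2)"
    have r: "0 < r" "r < R" "r < e" using e R by (auto simp: r_def)
    have "y + (r / (2 * R)) *\<^sub>R (z - y) \<in> ball y r - S"
      using *[OF r(1,2)] r by (meson centre_in_cball divide_nonneg_pos less_le_not_le subsetD zero_less_numeral)
    with e r show False by (auto dest!: subsetD)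
  qed
  then have "y \<in> frontier S" using y S by (auto simp: frontier_def)
  moreover have "dist x y < \<delta>"
    using y(2)[OF xS] z dist_triangle[of x y z] by (simp add: dist_commute)
  ultimately show ?thesis using * R by (intro that[of y R]) blast+
qed

text \<open>The losses multiply as follows: \<open>q^2\<close> is the width of the density band
  selected by Baire, one factor \<open>q\<close> pays for the Lipschitz variation of
  \<open>ln D\<close> over a distance \<open>\<delta>\<close>, and a last \<open>q\<close> makes the
  density bound strict for the Vitali comparison. The lower bound \<open>a\<close> on the frontier
  and the upper bound \<open>q^4 * a\<close> nearby conflict where the support misses a fixed
  fraction of small balls.\<close>

lemma msupport_eq_UNIV:
  fixes \<rho> :: "'a::euclidean_space measure" and D :: "'a \<Rightarrow> real"
  assumes \<rho>: "\<rho> \<in> borel_prob_ac"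
    and pos: "\<And>x. x \<in> msupport \<rho> \<Longrightarrow> D x > 0"
    and lim: "\<And>x. x \<in> msupport \<rho> \<Longrightarrow>
      ((\<lambda>r. measure \<rho> (ball x r) / measure lborel (ball x r)) \<longlongrightarrow> D x) (at_right 0)"
    and "\<Lambda> \<ge> 0"
    and Lip: "\<And>C x y. C \<in> components (msupport \<rho>) \<Longrightarrow> x \<in> C \<Longrightarrow> y \<in> C \<Longrightarrow>
      ln (D x) \<le> ln (D y) + \<Lambda> * dist x y"
  shows "msupport \<rho> = UNIV"
proof (rule ccontr)
  assume "msupport \<rho> \<noteq> UNIV"
  interpret prob_space \<rho> using \<rho> by (auto simp: borel_prob_ac_def borel_prob_def)
  have sets[measurable_cong]: "sets \<rho> = sets borel"
    using \<rho> by (auto simp: borel_prob_ac_def borel_prob_def)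
  have ac: "absolutely_continuous lborel \<rho>" using \<rho> by (auto simp: borel_prob_ac_def)
  define S where "S = msupport \<rho>"
  define F where "F = frontier S"
  define v where "v r = measure lborel (ball (0::'a) r)" for r
  have S: "closed S" by (simp add: S_def closed_msupport)
  have FS: "F \<subseteq> S" using S by (simp add: F_def frontier_subset_closed)
  have v: "r > 0 \<Longrightarrow> v r > 0" for r by (simp add: v_def content_ball_pos)
  have null: "- S \<in> null_sets \<rho>" unfolding S_def by (rule emeasure_Compl_msupport) (rule sets)
  have "S \<noteq> {}"
    using null emeasure_space_1 sets_eq_imp_space_eq[OF sets] by (auto simp: null_sets_def)
  then have F: "F \<noteq> {}" "closed F"
    using \<open>msupport \<rho> \<noteq> UNIV\<close> by (auto simp: F_def frontier_eq_empty S_def)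
  define \<kappa> where "\<kappa> = 1 - (1/4::real) ^ DIM('a)"
  \<comment> \<open>\<open>\<kappa>\<close> bounds the fraction of a small ball that the support can fill at a point with an exterior
    ball; the densities below are controlled up to the factor \<open>q^4\<close>, and \<open>q^4 * \<kappa> < 1\<close>.\<close>
  define q where "q = \<kappa> powr (-1/5)"
  have "(1/4::real) ^ DIM('a) \<le> (1/4) ^ 1" by (intro power_decreasing) auto
  then have \<kappa>: "0 < \<kappa>" "\<kappa> < 1" by (auto simp: \<kappa>_def)
  have q: "q > 1" using \<kappa> by (simp add: q_def powr_less_mono2_neg[of "-1/5" \<kappa> 1, simplified])
  \<comment> \<open>By the choice of exponent \<open>q^5 * \<kappa> = 1\<close>, so the product is
    \<open>1 / q\<close>.\<close>
  have q4: "q ^ 4 * \<kappa> < 1"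
  proof -
    have "q ^ 4 * \<kappa> = \<kappa> powr (- 4/5) * \<kappa> powr 1"
      using \<kappa> by (simp add: q_def powr_power)
    also have "\<dots> = \<kappa> powr (1/5)" by (simp only: powr_add[symmetric]) simp
    also have "\<dots> < 1" using \<kappa> powr_less_mono2[of "1/5" \<kappa> 1] by simp
    finally show ?thesis .
  qed
  \<comment> \<open>Frontier points are sorted by a band \<open>k\<close> for their ball averages
    and by a scale \<open>n\<close> below which all averages stay in the band. Fixing the scale,
    with non-strict inequalities, makes each set closed.\<close>
  define E where "E = (\<lambda>(k::int, n::nat). F \<inter> (\<Inter>r\<in>{0<..<1 / real (Suc n)}.
     {x. q powr k * v r \<le> measure \<rho> (ball x r)} \<inter> {x. measure \<rho> (ball x r) \<le> q powr (real_of_int k + 2) * v r}))"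
  have mem_E: "x \<in> E (k, n) \<longleftrightarrow> x \<in> F \<and> (\<forall>r. 0 < r \<longrightarrow> r < 1 / real (Suc n) \<longrightarrow>
      q powr k * v r \<le> measure \<rho> (ball x r) \<and> measure \<rho> (ball x r) \<le> q powr (real_of_int k + 2) * v r)" for x k n
    by (simp only: E_def prod.case Int_iff INT_iff mem_Collect_eq greaterThanLessThan_iff Ball_def imp_conjL)
  have "closed (E i)" for i
    by (cases i, simp only: E_def prod.case,
        intro closed_Int F closed_INT ballI closed_Collect_le continuous_on_const
          continuous_measure_ball[OF \<rho>])
  moreover have "F \<subseteq> (\<Union>i\<in>UNIV. E i)"
  proof
    fix x assume x: "x \<in> F"
    with FS have "x \<in> msupport \<rho>" by (auto simp: S_def)
    note D = pos[OF this] lim[OF this]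
    \<comment> \<open>The bands overlap, and this \<open>k\<close> puts \<open>D x\<close> strictly
      inside one of them, even if \<open>log q (D x)\<close> is an integer. The averages are then
      eventually in the same band.\<close>
    define k where "k = \<lceil>log q (D x)\<rceil> - 1"
    have "real_of_int k < log q (D x)" "log q (D x) < real_of_int k + 2"
      unfolding k_def by linarith+
    then have "q powr k < D x" "D x < q powr (real_of_int k + 2)"
      using D q by (simp_all add: less_log_iff log_less_iff)
    with order_tendstoD[OF D(2)]
    have "\<forall>\<^sub>F r in at_right 0. q powr k < measure \<rho> (ball x r) / measure lborel (ball x r) \<and>
       measure \<rho> (ball x r) / measure lborel (ball x r) < q powr (real_of_int k + 2)"
      by (simp add: eventually_conj)
    then obtain b where b: "b > 0" "\<And>r. 0 < r \<Longrightarrow> r < b \<Longrightarrow>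
       q powr k < measure \<rho> (ball x r) / v r \<and>
       measure \<rho> (ball x r) / v r < q powr (real_of_int k + 2)"
      unfolding eventually_at_right_field content_ball_0[of x] v_def by auto
    obtain n where n: "1 / real (Suc n) < b" using b(1) nat_approx_posE by blast
    have "x \<in> E (k, n)"
      unfolding mem_E
    proof (intro conjI allI impI)
      fix r assume r: "0 < r" "r < 1 / real (Suc n)"
      then have "r < b" using n by linarith
      with r b(2)[of r] v[of r]
      show "q powr k * v r \<le> measure \<rho> (ball x r)" "measure \<rho> (ball x r) \<le> q powr (real_of_int k + 2) * v r"
        by (auto simp: pos_less_divide_eq pos_divide_less_eq)
    qed (rule x)
    then show "x \<in> (\<Union>i\<in>UNIV. E i)" by blast
  qed
  ultimately obtain i x1 \<delta>1 where E: "x1 \<in> F" "\<delta>1 > 0" "F \<inter> ball x1 \<delta>1 \<subseteq> E i"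
    using Baire_closed_cover[OF F(2,1), of UNIV E thesis] by (simp del: split_paired_All)
  obtain k n where i: "i = (k, n)" by (cases i)
  define a where "a = q powr k"
  have a: "a > 0" using q by (simp add: a_def)
  have q2: "q powr (real_of_int k + 2) = q^2 * a" using q by (simp add: a_def powr_add)
  have Eb: "a * v r \<le> measure \<rho> (ball x r)" "measure \<rho> (ball x r) \<le> q^2 * a * v r"
    if "x \<in> F" "dist x1 x < \<delta>1" "0 < r" "r < 1 / Suc n" for x r
    using subsetD[OF E(3), of x] that unfolding i mem_E q2 by (auto simp: a_def simp del: of_nat_Suc)
  \<comment> \<open>The first bound keeps the nearest frontier point of a point in
    \<open>ball x1 \<delta>\<close> within the Baire portion; the second limits the Lipschitz
    variation of \<open>ln D\<close> to \<open>ln q\<close>. The denominator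
    \<open>1 + \<Lambda>\<close> also covers \<open>\<Lambda> = 0\<close>.\<close>
  define \<delta> where "\<delta> = min (\<delta>1 / 2) (ln q / (1 + \<Lambda>))"
  have \<delta>: "\<delta> > 0" "2 * \<delta> \<le> \<delta>1" using E q \<open>\<Lambda> \<ge> 0\<close> by (auto simp: \<delta>_def)
  have "\<Lambda> * \<delta> \<le> (1 + \<Lambda>) * (ln q / (1 + \<Lambda>))"
    using \<delta> \<open>\<Lambda> \<ge> 0\<close> by (intro mult_mono) (auto simp: \<delta>_def)
  then have \<Lambda>\<delta>: "\<Lambda> * \<delta> \<le> ln q" using \<open>\<Lambda> \<ge> 0\<close> by simp
  have DF: "D x \<le> q^2 * a" if x: "x \<in> F" "dist x1 x < \<delta>1" for x
  proof (rule tendsto_upperbound[OF lim])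
    show "x \<in> msupport \<rho>" using x FS by (auto simp: S_def)
    show "\<forall>\<^sub>F r in at_right 0. measure \<rho> (ball x r) / measure lborel (ball x r) \<le> q\<^sup>2 * a"
      unfolding eventually_at_right_field content_ball_0[of x] v_def[symmetric]
      using Eb(2)[OF x] v by (intro exI[of _ "1 / Suc n"]) (auto simp: pos_divide_le_eq simp del: of_nat_Suc)
  qed simp
  \<comment> \<open>The band bound at the frontier is carried to \<open>x\<close> through the
    nearest frontier point, which lies in the component of \<open>x\<close>, so that the Lipschitz
    bound is available.\<close>
  have DS: "D x \<le> q^3 * a" if x: "x \<in> S" "dist x1 x < \<delta>" for x
  proof -
    obtain y C where y: "y \<in> F" "C \<in> components S" "x \<in> C" "y \<in> C" "dist x y \<le> dist x x1"
      using obtain_frontier_same_component[OF S x(1), of x1] E(1) by (auto simp: F_def)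
    have "dist x1 y < \<delta>1" using y(5) x \<delta> dist_triangle[of x1 y x] by (simp add: dist_commute)
    then have Dy: "D y \<le> q^2 * a" using DF y by blast
    have p: "D x > 0" "D y > 0" using pos x y FS by (auto simp: S_def)
    have "ln (D x) \<le> ln (D y) + \<Lambda> * dist x y" using Lip y by (auto simp: S_def)
    also have "\<Lambda> * dist x y \<le> \<Lambda> * \<delta>" using y(5) x \<open>\<Lambda> \<ge> 0\<close> by (intro mult_left_mono) (auto simp: dist_commute)
    also have "\<dots> \<le> ln q" by (rule \<Lambda>\<delta>)
    also have "ln (D y) \<le> ln (q^2 * a)" using Dy p by (simp add: ln_mono)
    also have "ln (q^2 * a) + ln q = ln (q^3 * a)"
      using q a by (simp add: ln_mult ln_realpow)
    finally show ?thesis using p q a by simp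
  qed
  define c where "c = q^4 * a"
  have c: "c > 0" using q a by (simp add: c_def)
  \<comment> \<open>On \<open>S\<close> the averages tend to a limit below \<open>c\<close>; off
    \<open>S\<close> they vanish at small radii. Hence the Vitali comparison with \<open>c\<close>
    times Lebesgue measure applies.\<close>
  have le: "emeasure \<rho> G \<le> ennreal c * emeasure lborel G" if G: "open G" "G \<subseteq> ball x1 \<delta>" for G
  proof -
    have "emeasure \<rho> G \<le> emeasure (scale_measure (ennreal c) lborel) G"
    proof (rule Vitali_comparison[OF sets _ ac G(1)])
      fix x d assume x: "x \<in> G" and d: "(0::real) < d"
      obtain e where e: "e > 0" "ball x e \<subseteq> G" using G x by (auto simp: open_contains_ball)
      have "\<forall>\<^sub>F r in at_right 0. emeasure \<rho> (ball x r) \<le> emeasure (scale_measure (ennreal c) lborel) (ball x r)"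
      proof (cases "x \<in> S")
        case True
        have "D x \<le> q^3 * a" using True x G DS by auto
        also have "\<dots> < q^4 * a" using q a by (simp add: power_strict_increasing)
        finally have "D x < c" by (simp add: c_def)
        from order_tendstoD(2)[OF lim this] True
        have "\<forall>\<^sub>F r in at_right 0. measure \<rho> (ball x r) / v r < c"
          by (simp add: S_def v_def content_ball_0[of x])
        with eventually_at_right_less[of 0] show ?thesis
        proof eventually_elim
          case (elim r)
          then have "measure \<rho> (ball x r) \<le> c * v r" using v[of r] by (simp add: field_simps)
          then show ?case using c
            by (simp add: emeasure_lborel_ball v_def emeasure_eq_measure ennreal_mult'[symmetric])
        qed
      next
        case False
        then obtain e' where e': "e' > 0" "ball x e' \<subseteq> - S"
          using S by (metis ComplI open_Compl open_contains_ball)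
        have "emeasure \<rho> (ball x r) = 0" if "r < e'" for r
        proof -
          have "ball x r \<subseteq> - S" using e' that by (meson less_imp_le order_trans subset_ball)
          then show ?thesis
            using null_sets_subset[OF null, of "ball x r"] by (auto simp: sets null_sets_def)
        qed
        then show ?thesis using e'(1) by (auto simp: eventually_at_right_field)
      qed
      then obtain b where b: "b > 0" "\<And>r. 0 < r \<Longrightarrow> r < b \<Longrightarrow>
          emeasure \<rho> (ball x r) \<le> emeasure (scale_measure (ennreal c) lborel) (ball x r)"
        by (auto simp: eventually_at_right_field)
      define r where "r = min (d / 2) (min (b / 2) e)"
      have "0 < r" "r < d" "r < b" "r \<le> e" using d b e by (auto simp: r_def)
      with b e show "\<exists>r>0. r < d \<and> ball x r \<subseteq> G \<and>
          emeasure \<rho> (ball x r) \<le> emeasure (scale_measure (ennreal c) lborel) (ball x r)"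
        by (meson order_trans subset_ball)
    qed simp
    then show ?thesis by simp
  qed
  obtain y R where y: "y \<in> F" "dist x1 y < \<delta>" "R > 0"
    "\<And>r. 0 < r \<Longrightarrow> r < R \<Longrightarrow> \<exists>c. cball c (r / 4) \<subseteq> ball y r - S"
    using obtain_exterior_ball[OF S, of x1 \<delta>] E(1) \<delta> unfolding F_def by blast
  \<comment> \<open>The radius has to admit the exterior ball at \<open>y\<close>, stay below the
    Baire scale, and keep \<open>ball y r\<close> in the region where the upper bound
    \<open>le\<close> holds.\<close>
  define r where "r = min (R / 2) (min (1 / Suc n / 2) (\<delta> - dist x1 y))"
  have r: "0 < r" "r < R" "r < 1 / Suc n" "r \<le> \<delta> - dist x1 y"
    using y(2,3) by (auto simp: r_def min_less_iff_disj field_simps)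
  have ry: "ball y r \<subseteq> ball x1 \<delta>" using r(4) by (simp add: ball_subset_ball_iff dist_commute)
  obtain p where p: "cball p (r / 4) \<subseteq> ball y r - S" using y(4) r by blast
  have np: "cball p (r / 4) \<in> null_sets \<rho>"
    using p by (intro null_sets_subset[OF null]) (auto simp: sets)
  \<comment> \<open>The lower bound counts the whole of \<open>ball y r\<close>, whereas the mass
    sits in the part outside \<open>cball p (r / 4)\<close>, whose volume is
    \<open>\<kappa> * v r\<close>.\<close>
  have "a * v r \<le> measure \<rho> (ball y r)" using Eb(1)[OF y(1)] y(2) r \<delta> by simp
  then have "ennreal (a * v r) \<le> emeasure \<rho> (ball y r)" by (simp add: emeasure_eq_measure)
  also have "\<dots> = emeasure \<rho> (ball y r - cball p (r / 4))"
    using np by (intro emeasure_Diff_null_set[symmetric]) (auto simp: sets)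
  also have "\<dots> \<le> ennreal c * emeasure lborel (ball y r - cball p (r / 4))"
    using ry by (intro le) auto
  also have "emeasure lborel (ball y r - cball p (r / 4)) =
      emeasure lborel (ball y r) - emeasure lborel (cball p (r / 4))"
    using p emeasure_lborel_cball_finite[of p "r / 4"] by (intro emeasure_Diff) auto
  also have "emeasure lborel (cball p (r / 4)) = ennreal ((1/4) ^ DIM('a) * v r)"
    using content_ball_quarter[OF r(1), of p] emeasure_eq_ennreal_measure[of lborel "cball p (r/4)"]
      emeasure_lborel_cball_finite[of p "r/4"]
    by (simp add: v_def less_top[symmetric])
  also have "emeasure lborel (ball y r) = ennreal (v r)" by (simp add: emeasure_lborel_ball v_def)
  also have "ennreal (v r) - ennreal ((1/4) ^ DIM('a) * v r) = ennreal (\<kappa> * v r)"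
    using v[OF r(1)] by (simp add: ennreal_minus \<kappa>_def left_diff_distrib)
  also have "ennreal c * \<dots> = ennreal (c * (\<kappa> * v r))"
    using c by (simp add: ennreal_mult'[symmetric])
  finally have "a * v r \<le> c * (\<kappa> * v r)" using c \<kappa> v[OF r(1)] by simp
  also have "\<dots> = (q^4 * \<kappa>) * (a * v r)" by (simp add: c_def)
  also have "\<dots> < 1 * (a * v r)" using q4 a v[OF r(1)] by (intro mult_strict_right_mono) auto
  finally show False by simp
qed

section \<open>Nonexistence of critical points for bounded Lipschitz kernels\<close>

lemma ext_integral_nonneg:
  assumes "\<And>x. f x \<ge> 0"
  shows "ext_integral M f = enn2ereal (\<integral>\<^sup>+x. e2ennreal (f x) \<partial>M)"
  using assms by (simp add: ext_integral_def e2ennreal_neg zero_ennreal.rep_eq)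

text \<open>The value 0 also serves as the default for a missing limit; a nonzero value certifies
  that the ball averages converge.\<close>

lemma precise_density_tendsto:
  assumes "precise_density \<rho> x \<noteq> 0"
  shows "((\<lambda>r. measure \<rho> (ball x r) / measure lborel (ball x r)) \<longlongrightarrow> precise_density \<rho> x) (at_right 0)"
  using assms unfolding precise_density_def Let_def
  by (auto split: if_splits simp: tendsto_Lim)

lemma precise_density_nonneg: "precise_density \<rho> x \<ge> 0"
proof (cases "precise_density \<rho> x = 0")
  case False
  show ?thesis
    by (rule tendsto_lowerbound[OF precise_density_tendsto[OF False]]) auto
qed simp

lemma conv_Lipschitz:
  fixes w :: "'a::euclidean_space \<Rightarrow> real"
  assumes \<rho>: "\<rho> \<in> borel_prob"
    and w: "\<And>x. 0 \<le> w x" "\<And>x. w x \<le> M" "L-lipschitz_on UNIV w"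
  obtains \<phi> where "\<And>x. conv (\<lambda>x. ereal (w x)) \<rho> x = ereal (\<phi> x)"
    "\<And>x. \<phi> x \<le> M" "\<And>x y. \<phi> x \<le> \<phi> y + L * dist x y"
proof -
  interpret prob_space \<rho> using \<rho> by (auto simp: borel_prob_def)
  have [measurable_cong]: "sets \<rho> = sets borel" using \<rho> by (auto simp: borel_prob_def)
  have [measurable]: "w \<in> borel_measurable borel"
    using w(3) lipschitz_on_continuous_on by (intro borel_measurable_continuous_onI) blast
  have int: "integrable \<rho> (\<lambda>y. w (x - y))" for x
    by (rule integrable_const_bound[of _ M]) (use w in auto)
  define \<phi> where "\<phi> x = (\<integral>y. w (x - y) \<partial>\<rho>)" for x
  show ?thesis
  proof
    fix x y
    have "conv (\<lambda>x. ereal (w x)) \<rho> x = enn2ereal (\<integral>\<^sup>+y. ennreal (w (x - y)) \<partial>\<rho>)"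
      by (simp add: conv_def ext_integral_nonneg w)
    also have "\<dots> = enn2ereal (ennreal (\<phi> x))"
      by (simp add: nn_integral_eq_integral[OF int] w \<phi>_def)
    finally show "conv (\<lambda>x. ereal (w x)) \<rho> x = ereal (\<phi> x)"
      by (simp add: \<phi>_def w integral_nonneg_AE enn2ereal_ennreal)
    have "\<phi> x \<le> (\<integral>y. M \<partial>\<rho>)" unfolding \<phi>_def by (rule integral_mono[OF int]) (auto simp: w)
    then show "\<phi> x \<le> M" by (simp add: prob_space)
    have "\<phi> x \<le> (\<integral>u. w (y - u) + L * dist x y \<partial>\<rho>)" unfolding \<phi>_def
    proof (rule integral_mono[OF int])
      fix u
      have "dist (w (x - u)) (w (y - u)) \<le> L * dist (x - u) (y - u)"
        using w(3) by (auto simp: lipschitz_on_def)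
      then show "w (x - u) \<le> w (y - u) + L * dist x y" by (simp add: dist_norm)
    qed (auto intro!: int)
    also have "\<dots> = \<phi> y + L * dist x y" by (simp add: \<phi>_def int prob_space)
    finally show "\<phi> x \<le> \<phi> y + L * dist x y" .
  qed
qed

text \<open>The equation determines \<open>ln D\<close> from the potential up to a constant on each
  component, so the Lipschitz constant \<open>L / \<epsilon>\<close> is common to all components, as
  \<open>msupport_eq_UNIV\<close> requires. When the support is the whole space, the bounded
  potential keeps the density away from 0, which contradicts finite mass.\<close>

lemma no_critical_point:
  fixes w :: "'a::euclidean_space \<Rightarrow> real"
  assumes \<rho>: "\<rho> \<in> borel_prob_ac" and "\<epsilon> > 0"
    and w: "\<And>x. 0 \<le> w x" "\<And>x. w x \<le> M" "L-lipschitz_on UNIV w"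
  shows "\<not> critical_point (\<lambda>x. ereal (w x)) \<epsilon> \<rho>"
proof
  assume crit: "critical_point (\<lambda>x. ereal (w x)) \<epsilon> \<rho>"
  interpret prob_space \<rho> using \<rho> by (auto simp: borel_prob_ac_def borel_prob_def)
  have sets: "sets \<rho> = sets borel" and ac: "absolutely_continuous lborel \<rho>"
    using \<rho> by (auto simp: borel_prob_ac_def borel_prob_def)
  have "\<rho> \<in> borel_prob" using \<rho> by (simp add: borel_prob_ac_def)
  from conv_Lipschitz[OF this w] obtain \<phi> where \<phi>: "\<And>x. conv (\<lambda>x. ereal (w x)) \<rho> x = ereal (\<phi> x)"
    "\<And>x. \<phi> x \<le> M" "\<And>x y. \<phi> x \<le> \<phi> y + L * dist x y" by metis
  define D where "D = precise_density \<rho>"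
  have "L \<ge> 0" using w(3) by (simp add: lipschitz_on_def)
  have EL: "\<exists>c. \<forall>x\<in>C. D x > 0 \<and> ln (D x) = (c - \<phi> x) / \<epsilon> - 1" if "C \<in> components (msupport \<rho>)" for C
  proof -
    from crit that obtain c where
      c: "\<And>x. x \<in> C \<Longrightarrow> ereal \<epsilon> * U_lin' (precise_density \<rho> x) + conv (\<lambda>x. ereal (w x)) \<rho> x = ereal c"
      unfolding critical_point_def by blast
    show ?thesis
    proof (intro exI[of _ c] ballI conjI)
      fix x assume x: "x \<in> C"
      \<comment> \<open>At a zero of \<open>D\<close> the term \<open>U_lin'\<close> is
        \<open>-\<infinity>\<close>, and a real potential cannot bring the sum back to a real
        constant.\<close>
      have ne: "D x \<noteq> 0"
      proof
        assume "D x = 0"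
        then show False using c[OF x] \<open>\<epsilon> > 0\<close> by (simp add: U_lin'_def D_def \<phi>)
      qed
      then show "D x > 0" using precise_density_nonneg[of \<rho> x] by (simp add: D_def)
      have "\<epsilon> * (ln (D x) + 1) + \<phi> x = c" using c[OF x] ne by (simp add: U_lin'_def D_def \<phi>)
      then show "ln (D x) = (c - \<phi> x) / \<epsilon> - 1" using \<open>\<epsilon> > 0\<close> by (auto simp: field_simps)
    qed
  qed
  have pos: "D x > 0" if "x \<in> msupport \<rho>" for x
    using EL that by (metis UnionE Union_components)
  have UNIV: "msupport \<rho> = UNIV"
  proof (rule msupport_eq_UNIV[OF \<rho> pos])
    fix x assume "x \<in> msupport \<rho>"
    from pos[OF this]
    show "((\<lambda>r. measure \<rho> (ball x r) / measure lborel (ball x r)) \<longlongrightarrow> D x) (at_right 0)"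
      unfolding D_def by (intro precise_density_tendsto) simp
  next
    show "L / \<epsilon> \<ge> 0" using \<open>L \<ge> 0\<close> \<open>\<epsilon> > 0\<close> by simp
    fix C x y assume C: "C \<in> components (msupport \<rho>)" "x \<in> C" "y \<in> C"
    from EL[OF C(1)] obtain c where
      "ln (D x) = (c - \<phi> x) / \<epsilon> - 1" "ln (D y) = (c - \<phi> y) / \<epsilon> - 1" using C by blast
    then show "ln (D x) \<le> ln (D y) + L / \<epsilon> * dist x y"
      using \<phi>(3)[of y x] \<open>\<epsilon> > 0\<close> by (simp add: field_simps dist_commute)
  qed
  \<comment> \<open>The whole space is a single component, so one constant serves
    everywhere.\<close>
  from EL[of UNIV] obtain c where c: "\<And>x. D x > 0" "\<And>x. ln (D x) = (c - \<phi> x) / \<epsilon> - 1"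
    by (auto simp: UNIV)
  \<comment> \<open>Half of the lower bound for \<open>D\<close> that follows from
    \<open>\<phi> x \<le> M\<close>; the half makes the inequality strict, so it passes to averages
    over small balls.\<close>
  define b where "b = exp ((c - M) / \<epsilon> - 1) / 2"
  have b: "b > 0" by (simp add: b_def)
  have "emeasure (scale_measure (ennreal b) lborel) (UNIV :: 'a set) \<le> emeasure \<rho> UNIV"
  proof (rule Vitali_comparison[OF _ sets])
    show "absolutely_continuous lborel (scale_measure (ennreal b) lborel)"
      by (auto simp: absolutely_continuous_def null_sets_def)
    fix x :: 'a and d :: real assume d: "0 < d"
    have "(c - M) / \<epsilon> - 1 \<le> ln (D x)" using \<phi>(2)[of x] \<open>\<epsilon> > 0\<close> by (simp add: c divide_right_mono)
    then have "2 * b \<le> D x" using c(1)[of x] by (simp add: b_def ln_ge_iff)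
    then have "b < precise_density \<rho> x" "precise_density \<rho> x \<noteq> 0" using b by (auto simp: D_def)
    from order_tendstoD(1)[OF precise_density_tendsto[OF this(2)] this(1)]
    obtain e where e: "e > 0" "\<And>r. 0 < r \<Longrightarrow> r < e \<Longrightarrow> b < measure \<rho> (ball x r) / measure lborel (ball (0::'a) r)"
      by (auto simp: eventually_at_right_field content_ball_0[of x])
    define r where "r = min (d / 2) (e / 2)"
    have r: "0 < r" "r < d" "r < e" using d e by (auto simp: r_def)
    have "measure lborel (ball (0::'a) r) > 0" using r by (simp add: content_ball_pos)
    then have "b * measure lborel (ball (0::'a) r) \<le> measure \<rho> (ball x r)"
      using e(2)[OF r(1,3)] by (simp add: field_simps)
    then have "emeasure (scale_measure (ennreal b) lborel) (ball x r) \<le> emeasure \<rho> (ball x r)"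
      using b by (simp add: emeasure_lborel_ball emeasure_eq_measure ennreal_mult'[symmetric])
    with r show "\<exists>r>0. r < d \<and> ball x r \<subseteq> UNIV \<and>
        emeasure (scale_measure (ennreal b) lborel) (ball x r) \<le> emeasure \<rho> (ball x r)" by blast
  qed auto
  also have "\<dots> \<le> 1" by (rule emeasure_le_1)
  finally show False using b by (simp add: ennreal_mult_top top_unique)
qed

section \<open>Energies of densities\<close>

text \<open>Lower semicontinuity upgrades the almost-everywhere bound to every point: if
  \<open>W x > M\<close>, the same holds on a nonempty open set, which has positive Lebesgue
  measure. The strict inequality \<open>norm x > \<delta>\<close> leaves room for a
  neighbourhood.\<close>

lemma Linfty_on_lower_semicontinuous_bound:
  fixes W :: "'a::euclidean_space \<Rightarrow> ereal"
  assumes lsc: "lower_semicontinuous W" and W: "Linfty_on (UNIV - ball 0 \<delta>) W"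
  obtains M where "M \<ge> 0" "\<And>x. norm x > \<delta> \<Longrightarrow> W x \<le> ereal M"
proof -
  from W obtain M where M: "AE x in lborel. x \<in> UNIV - ball 0 \<delta> \<longrightarrow> \<bar>W x\<bar> \<le> ereal M"
    by (auto simp: Linfty_on_def)
  have "W x \<le> ereal M" if x: "norm x > \<delta>" for x
  proof (rule ccontr)
    assume "\<not> W x \<le> ereal M"
    with lsc obtain U where U: "open U" "x \<in> U" "\<And>y. y \<in> U \<Longrightarrow> ereal M < W y"
      unfolding lower_semicontinuous_def eventually_nhds by (metis not_le)
    define G where "G = U \<inter> - cball 0 \<delta>"
    have G: "open G" "G \<noteq> {}" using U x by (auto simp: G_def)
    from M have "AE y in lborel. y \<notin> G"
    proof eventually_elim
      case (elim y)
      show ?case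
      proof
        assume y: "y \<in> G"
        then have "\<bar>W y\<bar> \<le> ereal M" using elim by (auto simp: G_def)
        then have "W y \<le> ereal M" by (cases "W y") auto
        moreover have "ereal M < W y" using U(3) y by (auto simp: G_def)
        ultimately show False by simp
      qed
    qed
    then have "G \<in> null_sets lborel" using G by (simp add: AE_iff_null_sets)
    then have "negligible G" by (simp add: negligible_iff_null_sets null_sets_completionI)
    with G show False using open_not_negligible by blast
  qed
  moreover have "ereal M \<le> ereal (max M 0)" by simp
  ultimately have "W x \<le> ereal (max M 0)" if "norm x > \<delta>" for x using that order_trans by blast
  then show ?thesis by (intro that[of "max M 0"]) auto
qed

lemma borel_balls [measurable]: "ball x r \<in> sets borel" "cball x r \<in> sets borel"
  by auto

lemma nn_integral_lborel_translate:
  fixes f :: "'a::euclidean_space \<Rightarrow> ennreal"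
  assumes [measurable]: "f \<in> borel_measurable borel"
  shows "(\<integral>\<^sup>+x. f (x - y) \<partial>lborel) = (\<integral>\<^sup>+x. f x \<partial>lborel)"
proof -
  have "(\<integral>\<^sup>+x. f x \<partial>lborel) = (\<integral>\<^sup>+x. f x \<partial>distr lborel borel ((+) (- y)))"
    by (simp add: lborel_distr_plus)
  also have "\<dots> = (\<integral>\<^sup>+x. f (- y + x) \<partial>lborel)" by (subst nn_integral_distr) auto
  finally show ?thesis by simp
qed

text \<open>Split at distance 1 from \<open>y\<close>: nearby, \<open>g\<close> is at most
  \<open>b\<close> and translation invariance removes \<open>y\<close>; far away, \<open>V\<close>
  is at most \<open>M\<close> and \<open>g\<close> has mass at most 1. That the bound does not
  involve \<open>y\<close> is what later allows mass to be sent arbitrarily far.\<close>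

lemma potential_bound:
  fixes V g :: "'a::euclidean_space \<Rightarrow> ennreal"
  assumes [measurable]: "V \<in> borel_measurable borel" "g \<in> borel_measurable borel"
    and M: "\<And>x. norm x > 1 \<Longrightarrow> V x \<le> M"
    and g: "\<And>x. g x \<le> b" "(\<integral>\<^sup>+x. g x \<partial>lborel) \<le> 1"
  shows "(\<integral>\<^sup>+x. V (x - y) \<partial>density lborel g) \<le> b * (\<integral>\<^sup>+x\<in>cball 0 1. V x \<partial>lborel) + M"
proof -
  define V1 where "V1 = (\<lambda>x. V x * indicator (cball 0 1) x)"
  have [measurable]: "V1 \<in> borel_measurable borel" unfolding V1_def by measurable
  have "(\<integral>\<^sup>+x. V (x - y) \<partial>density lborel g) = (\<integral>\<^sup>+x. g x * V (x - y) \<partial>lborel)"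
    by (subst nn_integral_density) auto
  also have "\<dots> \<le> (\<integral>\<^sup>+x. b * V1 (x - y) + M * g x \<partial>lborel)"
  proof (rule nn_integral_mono)
    fix x
    show "g x * V (x - y) \<le> b * V1 (x - y) + M * g x"
    proof (cases "norm (x - y) \<le> 1")
      case True
      then show ?thesis using mult_right_mono[OF g(1)[of x], of "V (x - y)"]
        by (simp add: V1_def add_increasing2)
    next
      case False
      then show ?thesis using mult_left_mono[OF M[of "x - y"], of "g x"]
        by (simp add: V1_def mult.commute)
    qed
  qed
  also have "\<dots> = b * (\<integral>\<^sup>+x. V1 (x - y) \<partial>lborel) + M * (\<integral>\<^sup>+x. g x \<partial>lborel)"
    by (simp add: nn_integral_add nn_integral_cmult)
  also have "(\<integral>\<^sup>+x. V1 (x - y) \<partial>lborel) = (\<integral>\<^sup>+x. V1 x \<partial>lborel)"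
    by (rule nn_integral_lborel_translate) auto
  also have "M * (\<integral>\<^sup>+x. g x \<partial>lborel) \<le> M" using mult_left_mono[OF g(2), of M] by simp
  finally show ?thesis by (simp add: V1_def)
qed

section \<open>Extended integrals and the entropy of a density\<close>

lemma enn2ereal_eq_ereal_enn2real: "x < \<infinity> \<Longrightarrow> enn2ereal x = ereal (enn2real x)"
  by (cases x) (auto simp: enn2ereal_ennreal)

lemma ext_integral_integrable:
  assumes "integrable M f"
  shows "ext_integral M (\<lambda>x. ereal (f x)) = ereal (\<integral>x. f x \<partial>M)"
proof -
  have "(\<integral>\<^sup>+x. ennreal (f x) \<partial>M) < \<infinity>" "(\<integral>\<^sup>+x. ennreal (- f x) \<partial>M) < \<infinity>"
    using assms by (auto simp: real_integrable_def less_top)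
  then show ?thesis
    unfolding ext_integral_def real_lebesgue_integral_def[OF assms]
    by (simp add: enn2ereal_eq_ereal_enn2real)
qed

text \<open>The integrable majorant makes the positive part finite. If the negative part is infinite
  the value is \<open>-\<infinity>\<close>, so integrability of \<open>f\<close> need not be
  known.\<close>

lemma ext_integral_le:
  assumes [measurable]: "f \<in> borel_measurable M" and R: "integrable M R" and le: "\<And>x. f x \<le> R x"
  shows "ext_integral M (\<lambda>x. ereal (f x)) \<le> ereal (\<integral>x. R x \<partial>M)"
proof -
  have "(\<integral>\<^sup>+x. ennreal (f x) \<partial>M) \<le> (\<integral>\<^sup>+x. ennreal (R x) \<partial>M)"
    by (intro nn_integral_mono ennreal_leI le)
  also have "\<dots> < \<infinity>" using R by (auto simp: real_integrable_def less_top)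
  finally have P: "(\<integral>\<^sup>+x. ennreal (f x) \<partial>M) < \<infinity>" .
  show ?thesis
  proof (cases "(\<integral>\<^sup>+x. ennreal (- f x) \<partial>M) = \<infinity>")
    case True
    then show ?thesis using P
      by (simp add: ext_integral_def enn2ereal_eq_ereal_enn2real top_ennreal.rep_eq)
  next
    case False
    with P have "integrable M f" by (auto simp: real_integrable_def)
    then show ?thesis using R le by (simp add: ext_integral_integrable integral_mono)
  qed
qed

lemma integrable_if_ext_integral_less_top:
  assumes [measurable]: "f \<in> borel_measurable M"
    and neg: "(\<integral>\<^sup>+x. ennreal (- f x) \<partial>M) < \<infinity>"
    and "ext_integral M (\<lambda>x. ereal (f x)) < \<infinity>"
  shows "integrable M f"
  unfolding real_integrable_def
proof (intro conjI)
  show "(\<integral>\<^sup>+x. ennreal (f x) \<partial>M) \<noteq> \<infinity>"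
  proof
    assume "(\<integral>\<^sup>+x. ennreal (f x) \<partial>M) = \<infinity>"
    then have "ext_integral M (\<lambda>x. ereal (f x)) = \<infinity>"
      by (simp add: ext_integral_def)
    with assms show False by simp
  qed
qed (use neg in auto)

lemma internal_energy_density:
  fixes g :: "'a::euclidean_space \<Rightarrow> real"
  assumes [measurable]: "g \<in> borel_measurable borel" and g: "\<And>x. 0 \<le> g x"
    and prob: "prob_space (density lborel (\<lambda>x. ennreal (g x)))"
  shows "density lborel (\<lambda>x. ennreal (g x)) \<in> borel_prob_ac"
    and "internal_energy (density lborel (\<lambda>x. ennreal (g x))) = ext_integral lborel (\<lambda>x. ereal (U_lin (g x)))"
proof -
  let ?\<rho> = "density lborel (\<lambda>x. ennreal (g x))"
  show ac: "?\<rho> \<in> borel_prob_ac"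
    using prob by (auto simp: borel_prob_ac_def borel_prob_def absolutely_continuousI_density)
  have "AE x in lborel. ennreal (g x) = RN_deriv lborel ?\<rho> x"
    by (rule sigma_finite_measure.RN_deriv_unique[OF sigma_finite_lborel]) auto
  then have AE: "AE x in lborel. U_lin (enn2real (RN_deriv lborel ?\<rho> x)) = U_lin (g x)"
    by eventually_elim (metis g enn2real_ennreal)
  have "(\<integral>\<^sup>+x. e2ennreal (ereal (U_lin (enn2real (RN_deriv lborel ?\<rho> x)))) \<partial>lborel) =
      (\<integral>\<^sup>+x. e2ennreal (ereal (U_lin (g x))) \<partial>lborel)"
    using AE by (intro nn_integral_cong_AE) auto
  moreover have "(\<integral>\<^sup>+x. e2ennreal (- ereal (U_lin (enn2real (RN_deriv lborel ?\<rho> x)))) \<partial>lborel) =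
      (\<integral>\<^sup>+x. e2ennreal (- ereal (U_lin (g x))) \<partial>lborel)"
    using AE by (intro nn_integral_cong_AE) auto
  ultimately show "internal_energy ?\<rho> = ext_integral lborel (\<lambda>x. ereal (U_lin (g x)))"
    by (simp only: internal_energy_def ac if_True ext_integral_def)
qed

lemma borel_prob_ac_density:
  fixes \<rho> :: "'a::euclidean_space measure"
  assumes \<rho>: "\<rho> \<in> borel_prob_ac"
  obtains g where "g \<in> borel_measurable borel" "\<And>x. 0 \<le> g x" "\<rho> = density lborel (\<lambda>x. ennreal (g x))"
proof -
  have sets: "sets \<rho> = sets lborel" and ac: "absolutely_continuous lborel \<rho>"
    and "finite_measure \<rho>"
    using \<rho> by (auto simp: borel_prob_ac_def borel_prob_def prob_space_def)
  then obtain D where D: "D \<in> borel_measurable lborel" "AE x in lborel. RN_deriv lborel \<rho> x = ennreal (D x)"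
    "\<And>x. 0 \<le> D x"
    using sigma_finite_measure.real_RN_deriv[OF sigma_finite_lborel] by metis
  have "\<rho> = density lborel (RN_deriv lborel \<rho>)" using sigma_finite_measure.density_RN_deriv[OF sigma_finite_lborel ac sets] by simp
  also have "\<dots> = density lborel (\<lambda>x. ennreal (D x))" using D by (intro density_cong) auto
  finally show ?thesis using D by (intro that[of D]) auto
qed

text \<open>Young's inequality for the Legendre pair \<open>a ln a - a\<close> and \<open>exp\<close>.\<close>

lemma uminus_U_lin_le:
  assumes "a \<ge> 0"
  shows "- U_lin a \<le> a * h + exp (- h)"
proof (cases "a = 0")
  case False
  with assms have a: "a > 0" by simp
  have "ln (exp (- h) / a) \<le> exp (- h) / a - 1" using a by (intro ln_le_minus_one) auto
  then have "- h - ln a \<le> exp (- h) / a - 1" using a by (simp add: ln_div)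
  then have "a * (- h - ln a) \<le> a * (exp (- h) / a - 1)" using a by (intro mult_left_mono) auto
  then show ?thesis using a by (simp add: U_lin_def algebra_simps)
qed (simp add: U_lin_def)

text \<open>Where \<open>k \<le> norm x < k + 1\<close> the integrand is at most
  \<open>exp (- k)\<close>, and this shell lies in the ball of radius \<open>k + 1\<close>. The
  polynomial volume of that ball costs only half of the exponential decay, which leaves a geometric
  series with ratio \<open>exp (- 1/2)\<close>.\<close>

lemma nn_integral_exp_uminus_norm:
  "(\<integral>\<^sup>+x. ennreal (exp (- norm (x::'a::euclidean_space))) \<partial>lborel) < \<infinity>"
proof -
  define d where "d = DIM('a)"
  define u where "u k = unit_ball_vol (real d) * (2 ^ d * fact d * exp (1/2)) * exp (- 1/2) ^ k" for k :: nat
  have vol: "exp (- real k) * measure lborel (ball (0::'a) (real k + 1)) \<le> u k" for k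
  proof -
    \<comment> \<open>A single term of the exponential series at \<open>t\<close> dominates the
      power \<open>d\<close>; with this \<open>t\<close>, \<open>exp t\<close> uses up half of the
      decay.\<close>
    define t where "t = (real k + 1) / 2"
    have "t ^ d / fact d \<le> exp t"
    proof -
      have "(\<Sum>n\<in>{d}. t ^ n /\<^sub>R fact n) \<le> (\<Sum>n. t ^ n /\<^sub>R fact n)"
        by (rule sum_le_suminf[OF summable_exp_generic]) (auto simp: t_def)
      then show ?thesis by (simp add: exp_def divide_inverse mult.commute)
    qed
    then have "2 ^ d * t ^ d \<le> 2 ^ d * (fact d * exp t)"
      by (intro mult_left_mono) (auto simp: field_simps)
    moreover have "real k + 1 = 2 * t" by (simp add: t_def)
    ultimately have le: "(real k + 1) ^ d \<le> 2 ^ d * fact d * exp t"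
      by (simp add: power_mult_distrib del: of_nat_Suc)
    have "measure lborel (ball (0::'a) (real k + 1)) = unit_ball_vol (real d) * (real k + 1) ^ d"
      by (simp add: content_ball d_def)
    also have "\<dots> \<le> unit_ball_vol (real d) * (2 ^ d * fact d * exp t)"
      by (intro mult_left_mono le) auto
    finally have "exp (- real k) * measure lborel (ball (0::'a) (real k + 1)) \<le>
        exp (- real k) * (unit_ball_vol (real d) * (2 ^ d * fact d * exp t))"
      by (intro mult_left_mono) auto
    also have "exp (- real k) * (unit_ball_vol (real d) * (2 ^ d * fact d * exp t)) =
        unit_ball_vol (real d) * (2 ^ d * fact d) * exp (- real k + t)"
      by (simp only: exp_add mult_ac)
    also have "exp (- real k + t) = exp (1/2) * exp (- 1/2) ^ k"
      by (simp add: t_def exp_of_nat_mult[symmetric] exp_add[symmetric] field_simps)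
    finally show ?thesis by (simp add: u_def mult_ac)
  qed
  have "(\<integral>\<^sup>+x. ennreal (exp (- norm (x::'a))) \<partial>lborel) \<le>
      (\<integral>\<^sup>+x. (\<Sum>k. ennreal (exp (- real k)) * indicator (ball 0 (real k + 1)) (x::'a)) \<partial>lborel)"
  proof (rule nn_integral_mono)
    fix x :: 'a
    define k where "k = nat \<lfloor>norm x\<rfloor>"
    have k: "real k \<le> norm x" "norm x < real k + 1" by (auto simp: k_def)
    have "ennreal (exp (- norm x)) \<le> (\<Sum>k\<in>{k}. ennreal (exp (- real k)) * indicator (ball 0 (real k + 1)) x)"
      using k by (auto intro!: ennreal_leI)
    also have "\<dots> \<le> (\<Sum>k. ennreal (exp (- real k)) * indicator (ball 0 (real k + 1)) x)"
      by (rule sum_le_suminf) auto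
    finally show "ennreal (exp (- norm x)) \<le> \<dots>" .
  qed
  also have "\<dots> = (\<Sum>k. \<integral>\<^sup>+x. ennreal (exp (- real k)) * indicator (ball 0 (real k + 1)) (x::'a) \<partial>lborel)"
    by (rule nn_integral_suminf) auto
  also have "\<dots> = (\<Sum>k. ennreal (exp (- real k) * measure lborel (ball (0::'a) (real k + 1))))"
    by (simp add: nn_integral_cmult emeasure_lborel_ball ennreal_mult')
  also have "\<dots> \<le> (\<Sum>k. ennreal (u k))"
    by (intro suminf_le ennreal_leI vol) auto
  also have "\<dots> < \<infinity>"
  proof -
    have "summable u" unfolding u_def by (intro summable_mult summable_geometric) auto
    moreover have "u k \<ge> 0" for k by (simp add: u_def)
    ultimately show ?thesis by (simp add: suminf_ennreal2 less_top)
  qed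
  finally show ?thesis .
qed

text \<open>Young's inequality with \<open>h = norm x\<close>: the first moment controls one term,
  and the other is a fixed integrable function. Finite energy will therefore give an integrable
  entropy density.\<close>

lemma nn_integral_uminus_U_lin:
  fixes g :: "'a::euclidean_space \<Rightarrow> real"
  assumes [measurable]: "g \<in> borel_measurable borel" and g: "\<And>x. 0 \<le> g x"
    and moment: "(\<integral>\<^sup>+x. ennreal (norm x) \<partial>density lborel (\<lambda>x. ennreal (g x))) < \<infinity>"
  shows "(\<integral>\<^sup>+x. ennreal (- U_lin (g x)) \<partial>lborel) < \<infinity>"
proof -
  have "(\<integral>\<^sup>+x. ennreal (- U_lin (g x)) \<partial>lborel) \<le>
      (\<integral>\<^sup>+x. ennreal (g x) * ennreal (norm x) + ennreal (exp (- norm x)) \<partial>lborel)"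
  proof (rule nn_integral_mono)
    fix x
    have "ennreal (- U_lin (g x)) \<le> ennreal (g x * norm x + exp (- norm x))"
      by (intro ennreal_leI uminus_U_lin_le g)
    then show "ennreal (- U_lin (g x)) \<le> ennreal (g x) * ennreal (norm x) + ennreal (exp (- norm x))"
      using g by (simp add: ennreal_mult)
  qed
  also have "\<dots> = (\<integral>\<^sup>+x. ennreal (norm x) \<partial>density lborel (\<lambda>x. ennreal (g x))) +
      (\<integral>\<^sup>+x. ennreal (exp (- norm (x::'a))) \<partial>lborel)"
    by (simp add: nn_integral_add nn_integral_density)
  also have "\<dots> < \<infinity>" using moment nn_integral_exp_uminus_norm by (simp add: less_top)
  finally show ?thesis .
qed

section \<open>Couplings and Wasserstein distances\<close>

text \<open>The auxiliary probability space \<open>Q\<close> supplies randomness, so that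
  \<open>T\<close> may split the mass sitting at one point. The joint law of the starting point and
  \<open>T\<close> is then an explicit transport plan, and upper bounds on distances need no optimal
  plan.\<close>

locale coupling = M: prob_space \<rho> + Q: prob_space Q
  for \<rho> :: "'a::euclidean_space measure" and Q :: "'b measure" +
  fixes T :: "'a \<times> 'b \<Rightarrow> 'a" and \<nu> :: "'a measure"
  assumes sets_M [measurable_cong]: "sets \<rho> = sets borel"
    and T [measurable]: "T \<in> borel_measurable (\<rho> \<Otimes>\<^sub>M Q)"
    and \<nu>_def: "\<nu> = distr (\<rho> \<Otimes>\<^sub>M Q) borel T"
begin

sublocale P: pair_prob_space \<rho> Q ..

definition plan :: "('a \<times> 'a) measure" where
  "plan = distr (\<rho> \<Otimes>\<^sub>M Q) borel (\<lambda>z. (fst z, T z))"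

lemma fst_T_measurable [measurable]: "(\<lambda>z. (fst z, T z)) \<in> borel_measurable (\<rho> \<Otimes>\<^sub>M Q)"
  by (intro borel_measurable_Pair T) measurable

lemma target_borel_prob: "\<nu> \<in> borel_prob"
  unfolding \<nu>_def borel_prob_def by (auto intro!: P.prob_space_distr)

lemma distr_fst: "distr (\<rho> \<Otimes>\<^sub>M Q) borel fst = \<rho>"
proof -
  have "distr (\<rho> \<Otimes>\<^sub>M Q) borel fst = distr (\<rho> \<Otimes>\<^sub>M Q) \<rho> fst"
    by (intro distr_cong) (auto simp: sets_M)
  then show ?thesis by (simp add: Q.distr_pair_fst)
qed

lemma plan_in_transport_plans: "plan \<in> transport_plans \<rho> \<nu>"
proof -
  have [measurable]: "fst \<in> borel_measurable (borel :: ('a \<times> 'a) measure)"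
      "snd \<in> borel_measurable (borel :: ('a \<times> 'a) measure)"
    by (auto intro!: borel_measurable_continuous_onI continuous_intros)
  have "distr plan borel fst = \<rho>"
    unfolding plan_def by (subst distr_distr) (auto simp: comp_def distr_fst)
  moreover have "distr plan borel snd = \<nu>"
    unfolding plan_def \<nu>_def by (subst distr_distr) (auto simp: comp_def)
  moreover have "plan \<in> borel_prob"
    unfolding plan_def borel_prob_def by (auto intro!: P.prob_space_distr)
  ultimately show ?thesis by (simp add: transport_plans_def)
qed

lemma wasserstein_class_target:
  assumes p: "1 \<le> p" "p \<noteq> \<infinity>" and \<rho>: "\<rho> \<in> wasserstein_class p"
    and fin: "(\<integral>\<^sup>+z. ennreal (norm (fst z - T z) powr real_of_ereal p) \<partial>(\<rho> \<Otimes>\<^sub>M Q)) < \<infinity>"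
  shows "\<nu> \<in> wasserstein_class p"
proof -
  define q where "q = real_of_ereal p"
  have q: "q \<ge> 0" using p by (cases p) (auto simp: q_def)
  have "(\<integral>\<^sup>+x. ennreal (norm x powr q) \<partial>\<nu>) = (\<integral>\<^sup>+z. ennreal (norm (T z) powr q) \<partial>(\<rho> \<Otimes>\<^sub>M Q))"
    unfolding \<nu>_def by (subst nn_integral_distr) auto
  also have "\<dots> \<le> (\<integral>\<^sup>+z. ennreal (2 powr q) *
      (ennreal (norm (fst z) powr q) + ennreal (norm (fst z - T z) powr q)) \<partial>(\<rho> \<Otimes>\<^sub>M Q))"
  proof (rule nn_integral_mono)
    fix z
    let ?a = "norm (fst z)" and ?b = "norm (fst z - T z)"
    have "norm (T z) \<le> ?a + ?b" using norm_triangle_ineq4[of "fst z" "fst z - T z"] by simp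
    also have "\<dots> \<le> 2 * max ?a ?b" by simp
    finally have "norm (T z) powr q \<le> (2 * max ?a ?b) powr q" using q by (intro powr_mono2) auto
    also have "\<dots> = 2 powr q * max ?a ?b powr q" by (simp add: powr_mult)
    also have "max ?a ?b powr q \<le> ?a powr q + ?b powr q" by (simp add: max_def)
    finally have "ennreal (norm (T z) powr q) \<le> ennreal (2 powr q * (?a powr q + ?b powr q))"
      by (intro ennreal_leI) simp
    then show "ennreal (norm (T z) powr q) \<le> ennreal (2 powr q) * (ennreal (?a powr q) + ennreal (?b powr q))"
      by (simp add: ennreal_mult)
  qed
  also have "\<dots> = ennreal (2 powr q) * ((\<integral>\<^sup>+z. ennreal (norm (fst z) powr q) \<partial>(\<rho> \<Otimes>\<^sub>M Q)) +
      (\<integral>\<^sup>+z. ennreal (norm (fst z - T z) powr q) \<partial>(\<rho> \<Otimes>\<^sub>M Q)))"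
    by (simp add: nn_integral_cmult nn_integral_add)
  also have "(\<integral>\<^sup>+z. ennreal (norm (fst z) powr q) \<partial>(\<rho> \<Otimes>\<^sub>M Q)) = (\<integral>\<^sup>+x. ennreal (norm x powr q) \<partial>\<rho>)"
    by (subst (2) distr_fst[symmetric]) (simp add: nn_integral_distr)
  finally have "(\<integral>\<^sup>+x. ennreal (norm x powr q) \<partial>\<nu>) < \<infinity>"
    using fin \<rho> p by (auto simp: q_def wasserstein_class_def ennreal_mult_less_top less_top elim!: order_le_less_trans)
  then show ?thesis using target_borel_prob p by (simp add: wasserstein_class_def q_def)
qed

lemma wasserstein_le:
  assumes p: "1 \<le> p" "p \<noteq> \<infinity>" and "0 \<le> c"
    and le: "(\<integral>\<^sup>+z. ennreal (norm (fst z - T z) powr real_of_ereal p) \<partial>(\<rho> \<Otimes>\<^sub>M Q)) \<le> ennreal c"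
  shows "wasserstein p \<rho> \<nu> \<le> ennreal (c powr (1 / real_of_ereal p))"
proof -
  have q: "real_of_ereal p > 0" using p by (cases p) auto
  have "(INF \<pi>\<in>transport_plans \<rho> \<nu>. \<integral>\<^sup>+(x, y). ennreal (norm (x - y) powr real_of_ereal p) \<partial>\<pi>)
      \<le> (\<integral>\<^sup>+(x, y). ennreal (norm (x - y) powr real_of_ereal p) \<partial>plan)"
    by (rule INF_lower[OF plan_in_transport_plans])
  also have "\<dots> = (\<integral>\<^sup>+z. ennreal (norm (fst z - T z) powr real_of_ereal p) \<partial>(\<rho> \<Otimes>\<^sub>M Q))"
    unfolding plan_def by (subst nn_integral_distr) (auto simp: borel_prod[symmetric])
  also note le
  finally have "enn2real (INF \<pi>\<in>transport_plans \<rho> \<nu>. \<integral>\<^sup>+(x, y). ennreal (norm (x - y) powr real_of_ereal p) \<partial>\<pi>) \<le> c"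
    using \<open>0 \<le> c\<close> enn2real_mono by fastforce
  then show ?thesis using p q by (auto simp: wasserstein_def intro!: ennreal_leI powr_mono2)
qed

text \<open>The distance takes a supremum over the support of a plan, whereas the hypothesis holds
  only almost everywhere. Pairs at distance at most \<open>D\<close> form a closed set of full
  measure, which therefore contains the support.\<close>

lemma wasserstein_infinity_le:
  assumes AE: "AE z in \<rho> \<Otimes>\<^sub>M Q. norm (fst z - T z) \<le> D"
  shows "wasserstein \<infinity> \<rho> \<nu> \<le> ennreal D"
proof -
  define K where "K = {z::'a \<times> 'a. norm (fst z - snd z) \<le> D}"
  have K: "closed K" unfolding K_def by (intro closed_Collect_le continuous_intros)
  have "AE z in plan. z \<in> K"
    unfolding plan_def by (subst AE_distr_iff) (use AE K in \<open>auto simp: K_def\<close>)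
  then have "emeasure plan (- K) = 0"
    using K by (subst (asm) AE_iff_measurable[of "- K"]) (auto simp: plan_def)
  then have "msupport plan \<subseteq> K" using K by (intro msupport_subset)
  then have "(SUP (x, y)\<in>msupport plan. ennreal (norm (x - y))) \<le> ennreal D"
    by (intro SUP_least) (auto simp: K_def intro!: ennreal_leI)
  moreover have "wasserstein \<infinity> \<rho> \<nu> \<le> (SUP (x, y)\<in>msupport plan. ennreal (norm (x - y)))"
    by (simp add: wasserstein_def) (rule INF_lower[OF plan_in_transport_plans])
  ultimately show ?thesis by simp
qed

lemma wasserstein_class_infinity_target:
  assumes \<rho>: "\<rho> \<in> wasserstein_class \<infinity>" and AE: "AE z in \<rho> \<Otimes>\<^sub>M Q. norm (fst z - T z) \<le> D"
  shows "\<nu> \<in> wasserstein_class \<infinity>"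
proof -
  have "compact (msupport \<rho>)" using \<rho> by (simp add: wasserstein_class_def)
  then obtain R where R: "\<And>x. x \<in> msupport \<rho> \<Longrightarrow> norm x \<le> R"
    by (metis bounded_iff compact_imp_bounded)
  have "AE x in \<rho>. x \<in> msupport \<rho>"
    using AE_not_in[OF emeasure_Compl_msupport[OF sets_M]] by simp
  then have "AE x in distr (\<rho> \<Otimes>\<^sub>M Q) borel fst. x \<in> msupport \<rho>" by (simp only: distr_fst)
  then have "AE z in \<rho> \<Otimes>\<^sub>M Q. fst z \<in> msupport \<rho>"
    by (subst (asm) AE_distr_iff) (auto simp: closed_msupport)
  with AE have "AE z in \<rho> \<Otimes>\<^sub>M Q. T z \<in> cball 0 (R + D)"
  proof eventually_elim
    case (elim z)
    then show ?case using R[of "fst z"] norm_triangle_ineq4[of "fst z" "fst z - T z"] by simp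
  qed
  then have "AE y in \<nu>. y \<in> cball 0 (R + D)" unfolding \<nu>_def by (subst AE_distr_iff) auto
  then have "emeasure \<nu> (- cball 0 (R + D)) = 0"
    by (subst (asm) AE_iff_measurable[of "- cball 0 (R + D)"]) (auto simp: \<nu>_def)
  then have "msupport \<nu> \<subseteq> cball 0 (R + D)" by (intro msupport_subset) auto
  then have "compact (msupport \<nu>)"
    using bounded_subset[OF bounded_cball] closed_msupport by (auto simp: compact_eq_bounded_closed)
  then show ?thesis using target_borel_prob by (simp add: wasserstein_class_def)
qed

end

text \<open>Every admissible class, including that of compactly supported measures, provides the
  moment needed to control the negative part of the entropy.\<close>

lemma wasserstein_class_first_moment:
  assumes p: "1 \<le> p" and \<rho>: "\<rho> \<in> wasserstein_class p"
  shows "(\<integral>\<^sup>+x. ennreal (norm x) \<partial>\<rho>) < \<infinity>"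
proof -
  interpret prob_space \<rho> using \<rho> by (auto simp: wasserstein_class_def borel_prob_def)
  have sets [measurable_cong]: "sets \<rho> = sets borel" using \<rho> by (auto simp: wasserstein_class_def borel_prob_def)
  show ?thesis
  proof (cases "p = \<infinity>")
    case True
    with \<rho> have "compact (msupport \<rho>)" by (simp add: wasserstein_class_def)
    then obtain R where R: "\<And>x. x \<in> msupport \<rho> \<Longrightarrow> norm x \<le> R"
      by (metis bounded_iff compact_imp_bounded)
    have "(\<integral>\<^sup>+x. ennreal (norm x) \<partial>\<rho>) \<le> (\<integral>\<^sup>+x. ennreal R \<partial>\<rho>)"
      using AE_not_in[OF emeasure_Compl_msupport[OF sets]] R
      by (intro nn_integral_mono_AE) (auto elim!: eventually_mono intro!: ennreal_leI)
    then show ?thesis by (simp add: emeasure_space_1 order_le_less_trans)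
  next
    case False
    have q: "real_of_ereal p \<ge> 1" using p False by (cases p) auto
    have "(\<integral>\<^sup>+x. ennreal (norm x) \<partial>\<rho>) \<le> (\<integral>\<^sup>+x. 1 + ennreal (norm x powr real_of_ereal p) \<partial>\<rho>)"
    proof (rule nn_integral_mono)
      fix x
      have "norm x \<le> 1 + norm x powr real_of_ereal p"
      proof (cases "norm x \<le> 1")
        case True
        then show ?thesis by (simp add: add_increasing2)
      next
        case False
        then have "norm x powr 1 \<le> norm x powr real_of_ereal p" using q by (intro powr_mono) auto
        then show ?thesis using False by simp
      qed
      then show "ennreal (norm x) \<le> 1 + ennreal (norm x powr real_of_ereal p)"
        by (metis ennreal_1 ennreal_leI ennreal_plus powr_ge_zero zero_le_one)
    qed
    also have "\<dots> = 1 + (\<integral>\<^sup>+x. ennreal (norm x powr real_of_ereal p) \<partial>\<rho>)"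
      by (simp add: nn_integral_add emeasure_space_1)
    also have "\<dots> < \<infinity>" using \<rho> False by (simp add: wasserstein_class_def less_top)
    finally show ?thesis .
  qed
qed

section \<open>Mollification and mass transfer\<close>

text \<open>Twice the interaction energy for nonnegative kernels, kept in \<open>ennreal\<close> so
  that monotonicity and Fubini hold without integrability conditions.\<close>

definition interaction :: "('a::euclidean_space \<Rightarrow> ennreal) \<Rightarrow> 'a measure \<Rightarrow> ennreal" where
  "interaction V \<rho> = (\<integral>\<^sup>+y. \<integral>\<^sup>+x. V (x - y) \<partial>\<rho> \<partial>\<rho>)"

lemma interaction_energy_eq:
  fixes W :: "'a::euclidean_space \<Rightarrow> ereal"
  assumes "\<And>x. 0 \<le> W x"
  shows "interaction_energy W \<rho> = ereal (1/2) * enn2ereal (interaction (\<lambda>x. e2ennreal (W x)) \<rho>)"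
  unfolding interaction_energy_def interaction_def
  by (simp add: ext_integral_nonneg assms)

lemma prob_density_integral:
  fixes g :: "'a::euclidean_space \<Rightarrow> real"
  assumes "prob_space (density lborel (\<lambda>x. ennreal (g x)))"
    "g \<in> borel_measurable borel" "\<And>x. 0 \<le> g x"
  shows "integrable lborel g" "(\<integral>x. g x \<partial>lborel) = 1"
proof -
  have "(\<integral>\<^sup>+x. ennreal (g x) \<partial>lborel) = 1"
    using prob_space.emeasure_space_1[OF assms(1)] assms(2) by (simp add: emeasure_density)
  with assms show "integrable lborel g" "(\<integral>x. g x \<partial>lborel) = 1"
    by (auto simp: integrable_iff_bounded integral_eq_nn_integral)
qed

text \<open>An upper bound on the density makes the logarithm in the entropy at most a constant, and
  a uniformly bounded potential integrates to a finite interaction.\<close>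

lemma energy_bounded_density_finite:
  fixes W :: "'a::euclidean_space \<Rightarrow> ereal" and g :: "'a \<Rightarrow> real"
  defines "\<nu> \<equiv> density lborel (\<lambda>x. ennreal (g x))"
  assumes W: "\<And>x. 0 \<le> W x" and "\<epsilon> > 0"
    and g [measurable]: "g \<in> borel_measurable borel" and g0: "\<And>x. 0 \<le> g x"
    and b: "\<And>x. g x \<le> b" and prob: "prob_space \<nu>"
    and pot: "\<And>y. (\<integral>\<^sup>+x. e2ennreal (W (x - y)) \<partial>\<nu>) \<le> ennreal K"
  shows "energy W \<epsilon> \<nu> < \<infinity>"
proof -
  interpret prob_space \<nu> by (rule prob)
  define B where "B = max 0 (ln b)"
  have "interaction (\<lambda>x. e2ennreal (W x)) \<nu> \<le> (\<integral>\<^sup>+y. ennreal K \<partial>\<nu>)"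
    unfolding interaction_def by (intro nn_integral_mono pot)
  also have "\<dots> < \<infinity>" by (simp add: emeasure_space_1)
  finally have J: "interaction (\<lambda>x. e2ennreal (W x)) \<nu> < \<infinity>" .
  have U: "U_lin (g x) \<le> g x * B" for x
  proof (cases "g x = 0")
    case False
    then have "0 < g x" using g0[of x] by simp
    with b[of x] have "ln (g x) \<le> ln b" by (intro ln_mono) auto
    then show ?thesis using g0 by (auto simp: U_lin_def B_def intro!: mult_left_mono)
  qed (simp add: U_lin_def)
  have "internal_energy \<nu> = ext_integral lborel (\<lambda>x. ereal (U_lin (g x)))"
    unfolding \<nu>_def by (intro internal_energy_density g g0 prob[unfolded \<nu>_def])
  also have "\<dots> \<le> ereal (\<integral>x. g x * B \<partial>lborel)"
    using prob_density_integral[OF prob[unfolded \<nu>_def] g g0] U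
    by (intro ext_integral_le) (auto simp: U_lin_def)
  finally have "internal_energy \<nu> < \<infinity>" by (auto intro: le_less_trans)
  then have "ereal \<epsilon> * internal_energy \<nu> < \<infinity>" using \<open>\<epsilon> > 0\<close> by (cases "internal_energy \<nu>") auto
  then show ?thesis using J
    by (simp add: energy_def interaction_energy_eq[OF W] enn2ereal_eq_ereal_enn2real)
qed

definition unif :: "'a::euclidean_space \<Rightarrow> real \<Rightarrow> 'a measure" where
  "unif c R = density lborel (\<lambda>x. ennreal (indicator (ball c R) x / measure lborel (ball c R)))"

lemma unif:
  assumes "R > 0"
  shows "prob_space (unif c R)" "sets (unif c R) = sets borel" "AE x in unif c R. x \<in> ball c R"
proof -
  have v: "measure lborel (ball c R) > 0" using assms by (simp add: content_ball_pos)
  have "emeasure (unif c R) UNIV = (\<integral>\<^sup>+x. ennreal (1 / measure lborel (ball c R)) * indicator (ball c R) x \<partial>lborel)"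
    unfolding unif_def by (subst emeasure_density) (auto intro!: nn_integral_cong simp: indicator_def)
  also have "\<dots> = 1"
    using v by (simp add: nn_integral_cmult emeasure_lborel_ball content_ball_0[of c] ennreal_mult'[symmetric])
  finally show "prob_space (unif c R)" by (intro prob_spaceI) (simp add: unif_def)
  show "sets (unif c R) = sets borel" by (simp add: unif_def)
  show "AE x in unif c R. x \<in> ball c R"
    unfolding unif_def by (subst AE_density) (auto simp: indicator_def)
qed

text \<open>Adding an independent uniform sample from a ball convolves \<open>\<rho>\<close> with a
  bounded density. Realizing the convolution as the law of a sum yields a coupling with displacement
  at most \<open>\<delta>\<close> at the same time.\<close>

lemma mollification:
  fixes \<rho> :: "'a::euclidean_space measure"
  assumes \<rho>: "\<rho> \<in> borel_prob" and \<delta>: "\<delta> > 0"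
  obtains g where "g \<in> borel_measurable borel" "\<And>x. 0 \<le> g x" "\<And>x. g x \<le> 1 / measure lborel (ball (0::'a) \<delta>)"
    "distr (\<rho> \<Otimes>\<^sub>M unif 0 \<delta>) borel (\<lambda>z. fst z + snd z) = density lborel (\<lambda>x. ennreal (g x))"
proof -
  interpret M: prob_space \<rho> using \<rho> by (simp add: borel_prob_def)
  have [measurable_cong]: "sets \<rho> = sets borel" using \<rho> by (simp add: borel_prob_def)
  note [measurable_cong] = unif(2)[OF \<delta>]
  interpret Q: prob_space "unif (0::'a) \<delta>" by (rule unif(1)[OF \<delta>])
  define b where "b = 1 / measure lborel (ball (0::'a) \<delta>)"
  have b: "b \<ge> 0" by (simp add: b_def)
  have dens: "ennreal (indicator (ball 0 \<delta>) x / measure lborel (ball (0::'a) \<delta>)) = ennreal b * indicator (ball 0 \<delta>) x" for x :: 'a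
    by (simp add: b_def indicator_def)
  \<comment> \<open>This is the \<open>\<rho>\<close>-mass of \<open>ball y \<delta>\<close> divided
    by its volume.\<close>
  define h where "h y = ennreal b * (\<integral>\<^sup>+x. indicator (ball 0 \<delta>) (y - x) \<partial>\<rho>)" for y
  have h[measurable]: "h \<in> borel_measurable borel" unfolding h_def by measurable
  have hb: "h y \<le> ennreal b" for y
  proof -
    have "(\<integral>\<^sup>+x. indicator (ball 0 \<delta>) (y - x) \<partial>\<rho>) \<le> (\<integral>\<^sup>+x. 1 \<partial>\<rho>)"
      by (intro nn_integral_mono) (auto simp: indicator_def)
    then show ?thesis using mult_left_mono[of _ 1 "ennreal b"] by (simp add: h_def M.emeasure_space_1)
  qed
  have "distr (\<rho> \<Otimes>\<^sub>M unif 0 \<delta>) borel (\<lambda>z. fst z + snd z) = density lborel h"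
  proof (rule measure_eqI)
    fix S assume "S \<in> sets (distr (\<rho> \<Otimes>\<^sub>M unif 0 \<delta>) borel (\<lambda>z. fst z + snd z))"
    then have S[measurable]: "S \<in> sets borel" by simp
    have "emeasure (distr (\<rho> \<Otimes>\<^sub>M unif 0 \<delta>) borel (\<lambda>z. fst z + snd z)) S =
        (\<integral>\<^sup>+y. indicator S y \<partial>distr (\<rho> \<Otimes>\<^sub>M unif 0 \<delta>) borel (\<lambda>z. fst z + snd z))"
      by simp
    also have "\<dots> = (\<integral>\<^sup>+z. indicator S (fst z + snd z) \<partial>(\<rho> \<Otimes>\<^sub>M unif 0 \<delta>))"
      by (subst nn_integral_distr) auto
    also have "\<dots> = (\<integral>\<^sup>+x. \<integral>\<^sup>+u. indicator S (x + u) \<partial>unif 0 \<delta> \<partial>\<rho>)"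
      by (subst Q.nn_integral_fst[symmetric]) auto
    also have "\<dots> = (\<integral>\<^sup>+x. \<integral>\<^sup>+y. ennreal b * indicator (ball 0 \<delta>) (y - x) * indicator S y \<partial>lborel \<partial>\<rho>)"
    proof (rule nn_integral_cong)
      fix x
      have "(\<integral>\<^sup>+u. indicator S (x + u) \<partial>unif 0 \<delta>) =
          (\<integral>\<^sup>+u. ennreal b * indicator (ball 0 \<delta>) u * indicator S (x + u) \<partial>lborel)"
        unfolding unif_def dens by (subst nn_integral_density) auto
      also have "\<dots> = (\<integral>\<^sup>+y. ennreal b * indicator (ball 0 \<delta>) (y - x) * indicator S (x + (y - x)) \<partial>lborel)"
        by (rule nn_integral_lborel_translate[symmetric]) measurable
      finally show "(\<integral>\<^sup>+u. indicator S (x + u) \<partial>unif 0 \<delta>) =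
        (\<integral>\<^sup>+y. ennreal b * indicator (ball 0 \<delta>) (y - x) * indicator S y \<partial>lborel)" by simp
    qed
    also have "\<dots> = (\<integral>\<^sup>+y. \<integral>\<^sup>+x. ennreal b * indicator (ball 0 \<delta>) (y - x) * indicator S y \<partial>\<rho> \<partial>lborel)"
      by (intro pair_sigma_finite.Fubini'[symmetric] pair_sigma_finite.intro)
        (auto intro: M.sigma_finite_measure_axioms sigma_finite_lborel)
    also have "\<dots> = (\<integral>\<^sup>+y. h y * indicator S y \<partial>lborel)"
      by (simp add: h_def nn_integral_cmult nn_integral_multc)
    also have "\<dots> = emeasure (density lborel h) S" by (subst emeasure_density) auto
    finally show "emeasure (distr (\<rho> \<Otimes>\<^sub>M unif 0 \<delta>) borel (\<lambda>z. fst z + snd z)) S = emeasure (density lborel h) S" .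
  qed simp
  also have "\<dots> = density lborel (\<lambda>x. ennreal (enn2real (h x)))"
    using le_less_trans[OF hb ennreal_less_top] by (intro density_cong) auto
  finally show ?thesis
    using hb b by (intro that[of "\<lambda>x. enn2real (h x)"]) (auto simp: b_def[symmetric] enn2real_leI)
qed

text \<open>
  If the second argument is a coin with probability \<open>t\<close> of \<open>True\<close> and an independent sample of a
  measure \<open>\<eta>\<close>, this map moves a fraction \<open>t\<close> of the mass of \<open>A\<close> to \<open>\<eta>\<close>.
\<close>

definition transfer :: "'a set \<Rightarrow> 'a \<times> bool \<times> 'a \<Rightarrow> 'a" where
  "transfer A z = (if fst z \<in> A \<and> fst (snd z) then snd (snd z) else fst z)"

lemma measurable_transfer:
  fixes \<rho> \<eta> :: "'a::euclidean_space measure"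
  assumes [measurable_cong]: "sets \<rho> = sets borel" "sets \<eta> = sets borel" and [measurable]: "A \<in> sets borel"
  shows "transfer A \<in> borel_measurable (\<rho> \<Otimes>\<^sub>M (measure_pmf q \<Otimes>\<^sub>M \<eta>))"
  unfolding transfer_def by measurable

text \<open>Condition first on the starting point, then on the coin. Since \<open>F\<close> sees
  both the starting point and the end point, the formula yields the law of the moved measure as well
  as the transport cost.\<close>

lemma nn_integral_transfer:
  fixes \<rho> \<eta> :: "'a::euclidean_space measure" and F :: "'a \<Rightarrow> 'a \<Rightarrow> ennreal"
  assumes sets [measurable_cong]: "sets \<rho> = sets borel" "sets \<eta> = sets borel" and "prob_space \<eta>"
    and [measurable]: "A \<in> sets borel" and t: "0 \<le> t" "t \<le> 1"
    and [measurable]: "(\<lambda>(x, y). F x y) \<in> borel_measurable (borel \<Otimes>\<^sub>M borel)"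
  shows "(\<integral>\<^sup>+z. F (fst z) (transfer A z) \<partial>(\<rho> \<Otimes>\<^sub>M (measure_pmf (bernoulli_pmf t) \<Otimes>\<^sub>M \<eta>))) =
    (\<integral>\<^sup>+x. ennreal (1 - t * indicator A x) * F x x + ennreal (t * indicator A x) * (\<integral>\<^sup>+y. F x y \<partial>\<eta>) \<partial>\<rho>)"
proof -
  interpret N: prob_space \<eta> by fact
  interpret C: prob_space "measure_pmf (bernoulli_pmf t)" by (rule prob_space_measure_pmf)
  interpret P: pair_prob_space "measure_pmf (bernoulli_pmf t)" \<eta> ..
  note [measurable] = measurable_transfer[OF sets \<open>A \<in> sets borel\<close>]
  have "(\<integral>\<^sup>+z. F (fst z) (transfer A z) \<partial>(\<rho> \<Otimes>\<^sub>M (measure_pmf (bernoulli_pmf t) \<Otimes>\<^sub>M \<eta>))) =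
      (\<integral>\<^sup>+x. \<integral>\<^sup>+v. F x (transfer A (x, v)) \<partial>(measure_pmf (bernoulli_pmf t) \<Otimes>\<^sub>M \<eta>) \<partial>\<rho>)"
    by (subst P.nn_integral_fst[symmetric]) (auto intro!: measurable_compose_rev[OF measurable_Pair])
  also have "\<dots> = (\<integral>\<^sup>+x. ennreal (1 - t * indicator A x) * F x x + ennreal (t * indicator A x) * (\<integral>\<^sup>+y. F x y \<partial>\<eta>) \<partial>\<rho>)"
  proof (rule nn_integral_cong)
    fix x
    have [measurable]: "F x \<in> borel_measurable borel" by measurable
    have m: "(\<lambda>v. if x \<in> A \<and> fst v then snd v else x) \<in>
        borel_measurable (measure_pmf (bernoulli_pmf t) \<Otimes>\<^sub>M \<eta>)" by measurable
    have "(\<integral>\<^sup>+v. F x (transfer A (x, v)) \<partial>(measure_pmf (bernoulli_pmf t) \<Otimes>\<^sub>M \<eta>)) =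
        (\<integral>\<^sup>+u. \<integral>\<^sup>+y. F x (if x \<in> A \<and> u then y else x) \<partial>\<eta> \<partial>measure_pmf (bernoulli_pmf t))"
      using measurable_compose[OF m \<open>F x \<in> borel_measurable borel\<close>]
      by (subst N.nn_integral_fst[symmetric]) (auto simp: transfer_def cong: if_cong)
    also have "\<dots> = (\<integral>\<^sup>+y. F x (if x \<in> A \<and> True then y else x) \<partial>\<eta>) * ennreal t +
        (\<integral>\<^sup>+y. F x (if x \<in> A \<and> False then y else x) \<partial>\<eta>) * ennreal (1 - t)"
      using t by (subst nn_integral_bernoulli_pmf) auto
    also have "\<dots> = ennreal (1 - t * indicator A x) * F x x + ennreal (t * indicator A x) * (\<integral>\<^sup>+y. F x y \<partial>\<eta>)"
    proof (cases "x \<in> A")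
      case True
      then show ?thesis by (simp add: N.emeasure_space_1 mult.commute add.commute)
    next
      case False
      have "ennreal t + ennreal (1 - t) = 1" using t by (subst ennreal_plus[symmetric]) auto
      then have "F x x * ennreal t + F x x * ennreal (1 - t) = F x x" by (simp add: distrib_left[symmetric])
      then show ?thesis using False by (simp add: N.emeasure_space_1)
    qed
    finally show "(\<integral>\<^sup>+v. F x (transfer A (x, v)) \<partial>(measure_pmf (bernoulli_pmf t) \<Otimes>\<^sub>M \<eta>)) = \<dots>" .
  qed
  finally show ?thesis .
qed

section \<open>Change of entropy and interaction under a transfer of mass\<close>

lemma U_lin_scale:
  assumes "0 \<le> c" "c \<le> 1" "0 \<le> x"
  shows "U_lin (c * x) \<le> c * U_lin x"
proof (cases "c = 0 \<or> x = 0")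
  case False
  then have p: "0 < c" "0 < x" using assms by auto
  have "c * x * ln c \<le> 0" using p assms by (intro mult_nonneg_nonpos) auto
  then show ?thesis using p by (simp add: U_lin_def ln_mult algebra_simps)
qed (auto simp: U_lin_def)

text \<open>With \<open>z = x + y\<close>, the tangent of the logarithm at \<open>s\<close> bounds
  \<open>y * ln z\<close> and the tangent at \<open>x\<close> bounds \<open>x * ln z\<close>. The
  surplus \<open>y\<close> of the second estimate cancels the \<open>- y\<close> of the
  first.\<close>

lemma U_lin_add:
  assumes "0 \<le> x" "0 \<le> y" "0 < s"
  shows "U_lin (x + y) \<le> U_lin x + y * (ln s + (x + y) / s)"
proof (cases "x + y = 0")
  case False
  define z where "z = x + y"
  have z: "z > 0" using False assms by (simp add: z_def)
  have "ln (z / s) \<le> z / s - 1" using z assms by (intro ln_le_minus_one) auto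
  then have "y * ln z \<le> y * (ln s + z / s - 1)" using z assms by (intro mult_left_mono) (auto simp: ln_div)
  moreover have "x * ln z \<le> x * ln x + y"
  proof (cases "x = 0")
    case False
    then have x: "x > 0" using assms by simp
    have "ln (z / x) \<le> z / x - 1" using z x by (intro ln_le_minus_one) auto
    then have "x * (ln z - ln x) \<le> x * (z / x - 1)" using z x by (intro mult_left_mono) (auto simp: ln_div)
    also have "x * (z / x - 1) = y" using x by (simp add: z_def right_diff_distrib)
    finally show ?thesis by (simp add: right_diff_distrib)
  qed (use assms in simp)
  ultimately have "(x + y) * ln z \<le> x * ln x + y * (ln s + z / s)" by (simp add: algebra_simps)
  then show ?thesis by (simp add: U_lin_def z_def)
qed (use assms in \<open>auto simp: add_nonneg_eq_0_iff U_lin_def\<close>)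

text \<open>The comparison \<open>le\<close> is used once in each variable, with Fubini and symmetry
  for the cross term. No term quadratic in \<open>\<tau>\<close> appears, because the constant
  \<open>\<tau> * K\<close> is integrated against the probability measure
  \<open>\<nu>\<close>.\<close>

lemma interaction_perturbation:
  fixes V :: "'a::euclidean_space \<Rightarrow> ennreal" and \<rho> \<eta> \<nu> :: "'a measure"
  assumes sets [measurable_cong]: "sets \<rho> = sets borel" "sets \<eta> = sets borel" "sets \<nu> = sets borel"
    and prob: "prob_space \<rho>" "prob_space \<eta>" "prob_space \<nu>"
    and V [measurable]: "V \<in> borel_measurable borel" and sym: "\<And>x. V (- x) = V x"
    and K: "\<And>y. (\<integral>\<^sup>+x. V (x - y) \<partial>\<eta>) \<le> K"
    and le: "\<And>f. f \<in> borel_measurable borel \<Longrightarrow> (\<integral>\<^sup>+x. f x \<partial>\<nu>) \<le> (\<integral>\<^sup>+x. f x \<partial>\<rho>) + \<tau> * (\<integral>\<^sup>+x. f x \<partial>\<eta>)"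
  shows "interaction V \<nu> \<le> interaction V \<rho> + 2 * (\<tau> * K)"
proof -
  interpret R: prob_space \<rho> by fact
  interpret H: prob_space \<eta> by fact
  interpret N: prob_space \<nu> by fact
  interpret P: pair_prob_space \<rho> \<eta> ..
  define \<psi> where "\<psi> = (\<lambda>y. \<integral>\<^sup>+x. V (x - y) \<partial>\<rho>)"
  have [measurable]: "\<psi> \<in> borel_measurable borel" unfolding \<psi>_def by measurable
  have "interaction V \<nu> \<le> (\<integral>\<^sup>+y. \<psi> y + \<tau> * K \<partial>\<nu>)"
    unfolding interaction_def
  proof (rule nn_integral_mono)
    fix y
    have "(\<integral>\<^sup>+x. V (x - y) \<partial>\<nu>) \<le> \<psi> y + \<tau> * (\<integral>\<^sup>+x. V (x - y) \<partial>\<eta>)" unfolding \<psi>_def by (rule le) measurable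
    also have "\<dots> \<le> \<psi> y + \<tau> * K" by (intro add_left_mono mult_left_mono K) auto
    finally show "(\<integral>\<^sup>+x. V (x - y) \<partial>\<nu>) \<le> \<psi> y + \<tau> * K" .
  qed
  also have "\<dots> = (\<integral>\<^sup>+y. \<psi> y \<partial>\<nu>) + \<tau> * K"
    by (simp add: nn_integral_add N.emeasure_space_1)
  also have "(\<integral>\<^sup>+y. \<psi> y \<partial>\<nu>) \<le> (\<integral>\<^sup>+y. \<psi> y \<partial>\<rho>) + \<tau> * (\<integral>\<^sup>+y. \<psi> y \<partial>\<eta>)" by (rule le) measurable
  also have "(\<integral>\<^sup>+y. \<psi> y \<partial>\<eta>) = (\<integral>\<^sup>+x. \<integral>\<^sup>+y. V (x - y) \<partial>\<eta> \<partial>\<rho>)"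
    unfolding \<psi>_def by (rule P.Fubini') measurable
  also have "\<dots> = (\<integral>\<^sup>+x. \<integral>\<^sup>+y. V (y - x) \<partial>\<eta> \<partial>\<rho>)"
    by (intro nn_integral_cong) (metis minus_diff_eq sym)
  also have "\<dots> \<le> (\<integral>\<^sup>+x. K \<partial>\<rho>)" by (intro nn_integral_mono K)
  also have "\<dots> = K" by (simp add: R.emeasure_space_1)
  finally have "interaction V \<nu> \<le> (\<integral>\<^sup>+y. \<psi> y \<partial>\<rho>) + \<tau> * K + \<tau> * K"
    by (simp add: mult_left_mono add_mono)
  then show ?thesis by (simp add: interaction_def \<psi>_def add.assoc mult_2)
qed

lemma distr_transfer:
  fixes g :: "'a::euclidean_space \<Rightarrow> real"
  defines "\<rho> \<equiv> density lborel (\<lambda>x. ennreal (g x))"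
  assumes g [measurable]: "g \<in> borel_measurable borel" and g0: "\<And>x. 0 \<le> g x" and prob: "prob_space \<rho>"
    and A [measurable]: "A \<in> sets borel" and t: "0 \<le> t" "t \<le> 1" and R: "R > 0"
  shows "distr (\<rho> \<Otimes>\<^sub>M (measure_pmf (bernoulli_pmf t) \<Otimes>\<^sub>M unif c R)) borel (transfer A) =
    density lborel (\<lambda>x. ennreal ((1 - t * indicator A x) * g x +
      t * measure \<rho> A / measure lborel (ball c R) * indicator (ball c R) x))"
proof -
  interpret prob_space \<rho> by (rule prob)
  have sets [measurable_cong]: "sets \<rho> = sets borel" by (simp add: \<rho>_def)
  note unif = unif[OF R]
  note [measurable_cong] = unif(2)[of c]
  note [measurable] = measurable_transfer[OF sets unif(2)[of c] A]
  have c: "0 \<le> 1 - t * indicator A x" "0 \<le> t * indicator A x" for x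
    using t by (auto simp: indicator_def)
  let ?P = "\<rho> \<Otimes>\<^sub>M (measure_pmf (bernoulli_pmf t) \<Otimes>\<^sub>M unif c R)"
  show ?thesis
  proof (rule measure_eqI)
    fix S assume "S \<in> sets (distr ?P borel (transfer A))"
    then have S [measurable]: "S \<in> sets borel" by simp
    have u: "emeasure (unif c R) S = (\<integral>\<^sup>+x. ennreal (indicator (ball c R) x / measure lborel (ball c R)) * indicator S x \<partial>lborel)"
      unfolding unif_def by (subst emeasure_density) auto
    have "emeasure (distr ?P borel (transfer A)) S = (\<integral>\<^sup>+x. indicator S x \<partial>distr ?P borel (transfer A))" by simp
    also have "\<dots> = (\<integral>\<^sup>+z. indicator S (transfer A z) \<partial>?P)" by (subst nn_integral_distr) auto
    also have "\<dots> = (\<integral>\<^sup>+x. ennreal (1 - t * indicator A x) * indicator S x +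
        ennreal (t * indicator A x) * (\<integral>\<^sup>+y. indicator S y \<partial>unif c R) \<partial>\<rho>)"
      using t by (intro nn_integral_transfer sets unif A) auto
    also have "\<dots> = (\<integral>\<^sup>+x. ennreal (1 - t * indicator A x) * indicator S x \<partial>\<rho>) +
        (\<integral>\<^sup>+x. ennreal t * indicator A x * emeasure (unif c R) S \<partial>\<rho>)"
      using t by (subst nn_integral_add) (auto simp: ennreal_mult' ennreal_indicator intro!: nn_integral_cong)
    also have "(\<integral>\<^sup>+x. ennreal t * indicator A x * emeasure (unif c R) S \<partial>\<rho>) =
        ennreal (t * measure \<rho> A) * emeasure (unif c R) S"
      using t by (simp add: nn_integral_multc nn_integral_cmult emeasure_eq_measure ennreal_mult')
    also have "(\<integral>\<^sup>+x. ennreal (1 - t * indicator A x) * indicator S x \<partial>\<rho>) =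
        (\<integral>\<^sup>+x. ennreal ((1 - t * indicator A x) * g x) * indicator S x \<partial>lborel)"
      unfolding \<rho>_def using c g0
      by (subst nn_integral_density) (auto intro!: nn_integral_cong simp: ennreal_mult' mult_ac)
    also have "ennreal (t * measure \<rho> A) * emeasure (unif c R) S =
        (\<integral>\<^sup>+x. ennreal (t * measure \<rho> A) * (ennreal (indicator (ball c R) x / measure lborel (ball c R)) * indicator S x) \<partial>lborel)"
      unfolding u by (subst nn_integral_cmult) auto
    also have "(\<integral>\<^sup>+x. ennreal ((1 - t * indicator A x) * g x) * indicator S x \<partial>lborel) + \<dots> =
       (\<integral>\<^sup>+x. ennreal ((1 - t * indicator A x) * g x) * indicator S x +
          ennreal (t * measure \<rho> A) * (ennreal (indicator (ball c R) x / measure lborel (ball c R)) * indicator S x) \<partial>lborel)"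
      by (subst nn_integral_add) auto
    also have "\<dots> = (\<integral>\<^sup>+x. ennreal ((1 - t * indicator A x) * g x +
      t * measure \<rho> A / measure lborel (ball c R) * indicator (ball c R) x) * indicator S x \<partial>lborel)"
    proof (rule nn_integral_cong)
      fix x
      have "ennreal (t * measure \<rho> A) * ennreal (indicator (ball c R) x / measure lborel (ball c R)) =
          ennreal (t * measure \<rho> A / measure lborel (ball c R) * indicator (ball c R) x)"
        using t by (subst ennreal_mult'[symmetric]) (auto simp: mult_ac)
      moreover have "0 \<le> t * measure \<rho> A / measure lborel (ball c R) * indicator (ball c R) x"
        using t by auto
      ultimately show "ennreal ((1 - t * indicator A x) * g x) * indicator S x +
          ennreal (t * measure \<rho> A) * (ennreal (indicator (ball c R) x / measure lborel (ball c R)) * indicator S x) =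
          ennreal ((1 - t * indicator A x) * g x +
          t * measure \<rho> A / measure lborel (ball c R) * indicator (ball c R) x) * indicator S x"
        using c g0 by (simp add: mult.assoc[symmetric] ennreal_plus distrib_right)
    qed
    finally show "emeasure (distr ?P borel (transfer A)) S = emeasure (density lborel (\<lambda>x. ennreal ((1 - t * indicator A x) * g x +
      t * measure \<rho> A / measure lborel (ball c R) * indicator (ball c R) x))) S"
      by (subst emeasure_density) auto
  qed simp
qed

text \<open>Mass removed from \<open>A\<close> is ignored and mass added is counted in full. This is
  the hypothesis \<open>le\<close> of \<open>interaction_perturbation\<close> with
  \<open>\<tau>\<close> equal to the transferred mass.\<close>

lemma nn_integral_distr_transfer_le:
  fixes \<rho> \<eta> :: "'a::euclidean_space measure"
  assumes sets [measurable_cong]: "sets \<rho> = sets borel" "sets \<eta> = sets borel" and prob: "prob_space \<rho>" "prob_space \<eta>"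
    and A [measurable]: "A \<in> sets borel" and t: "0 \<le> t" "t \<le> 1"
    and f [measurable]: "f \<in> borel_measurable borel"
  shows "(\<integral>\<^sup>+x. f x \<partial>distr (\<rho> \<Otimes>\<^sub>M (measure_pmf (bernoulli_pmf t) \<Otimes>\<^sub>M \<eta>)) borel (transfer A))
     \<le> (\<integral>\<^sup>+x. f x \<partial>\<rho>) + ennreal (t * measure \<rho> A) * (\<integral>\<^sup>+x. f x \<partial>\<eta>)"
proof -
  interpret prob_space \<rho> by fact
  note [measurable] = measurable_transfer[OF sets A]
  let ?P = "\<rho> \<Otimes>\<^sub>M (measure_pmf (bernoulli_pmf t) \<Otimes>\<^sub>M \<eta>)"
  have "(\<integral>\<^sup>+x. f x \<partial>distr ?P borel (transfer A)) = (\<integral>\<^sup>+z. f (transfer A z) \<partial>?P)"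
    by (subst nn_integral_distr) auto
  also have "\<dots> = (\<integral>\<^sup>+x. ennreal (1 - t * indicator A x) * f x +
      ennreal (t * indicator A x) * (\<integral>\<^sup>+y. f y \<partial>\<eta>) \<partial>\<rho>)"
    using t by (intro nn_integral_transfer sets prob A) auto
  also have "\<dots> \<le> (\<integral>\<^sup>+x. f x + ennreal t * indicator A x * (\<integral>\<^sup>+y. f y \<partial>\<eta>) \<partial>\<rho>)"
  proof (intro nn_integral_mono add_mono)
    fix x
    have "ennreal (1 - t * indicator A x) \<le> 1" using t by (auto simp: indicator_def)
    then show "ennreal (1 - t * indicator A x) * f x \<le> f x" using mult_right_mono[of _ 1 "f x"] by simp
    show "ennreal (t * indicator A x) * (\<integral>\<^sup>+y. f y \<partial>\<eta>) \<le> ennreal t * indicator A x * (\<integral>\<^sup>+y. f y \<partial>\<eta>)"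
      using t by (simp add: ennreal_mult' ennreal_indicator)
  qed
  also have "\<dots> = (\<integral>\<^sup>+x. f x \<partial>\<rho>) + ennreal (t * measure \<rho> A) * (\<integral>\<^sup>+x. f x \<partial>\<eta>)"
    using t by (simp add: nn_integral_add nn_integral_cmult nn_integral_multc emeasure_eq_measure ennreal_mult')
  finally show ?thesis .
qed

text \<open>With \<open>m\<close> the mass of \<open>A\<close>, the interaction energy rises by at
  most \<open>t * m * K\<close> and the entropy by at most \<open>t * (m * (ln s + 1) - IA)\<close>,
  where \<open>IA\<close> is the entropy on \<open>A\<close>. Both bounds are linear in
  \<open>t\<close>, and \<open>neg\<close> says that the total slope is negative.\<close>

lemma energy_perturbation:
  fixes W :: "'a::euclidean_space \<Rightarrow> ereal" and g :: "'a \<Rightarrow> real"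
  defines "\<rho> \<equiv> density lborel (\<lambda>x. ennreal (g x))"
  assumes W: "\<And>x. 0 \<le> W x" "W \<in> borel_measurable borel" "\<And>x. W x = W (- x)" and "\<epsilon> > 0"
    and g [measurable]: "g \<in> borel_measurable borel" and g0: "\<And>x. 0 \<le> g x" and prob: "prob_space \<rho>"
    and int: "integrable lborel (\<lambda>x. U_lin (g x))"
    and fin: "interaction (\<lambda>x. e2ennreal (W x)) \<rho> < \<infinity>"
    and A [measurable]: "A \<in> sets borel" and t: "0 < t" "t \<le> 1" and R: "R > 0"
    and s: "s > 0" "measure \<rho> (ball c R) + t * measure \<rho> A \<le> s * measure lborel (ball c R)"
    and "K \<ge> 0" and K: "\<And>y. (\<integral>\<^sup>+x. e2ennreal (W (x - y)) \<partial>unif c R) \<le> ennreal K"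
    and neg: "measure \<rho> A * (K + \<epsilon> * (ln s + 1)) < \<epsilon> * (\<integral>x\<in>A. U_lin (g x) \<partial>lborel)"
  shows "energy W \<epsilon> (distr (\<rho> \<Otimes>\<^sub>M (measure_pmf (bernoulli_pmf t) \<Otimes>\<^sub>M unif c R)) borel (transfer A))
     < energy W \<epsilon> \<rho>"
proof -
  interpret prob_space \<rho> by (rule prob)
  have sets [measurable_cong]: "sets \<rho> = sets borel" by (simp add: \<rho>_def)
  interpret P: prob_space "\<rho> \<Otimes>\<^sub>M (measure_pmf (bernoulli_pmf t) \<Otimes>\<^sub>M unif c R)"
  proof -
    interpret N: prob_space "unif c R" by (rule unif[OF R])
    interpret C: prob_space "measure_pmf (bernoulli_pmf t)" by (rule prob_space_measure_pmf)
    interpret P: pair_prob_space "measure_pmf (bernoulli_pmf t)" "unif c R" ..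
    interpret P2: pair_prob_space \<rho> "measure_pmf (bernoulli_pmf t) \<Otimes>\<^sub>M unif c R" ..
    show "prob_space (\<rho> \<Otimes>\<^sub>M (measure_pmf (bernoulli_pmf t) \<Otimes>\<^sub>M unif c R))"
      by (rule P2.prob_space_axioms)
  qed
  define \<nu> where "\<nu> = distr (\<rho> \<Otimes>\<^sub>M (measure_pmf (bernoulli_pmf t) \<Otimes>\<^sub>M unif c R)) borel (transfer A)"
  define V where "V = (\<lambda>x. e2ennreal (W x))"
  define m where "m = measure \<rho> A"
  define v where "v = measure lborel (ball c R)"
  define y where "y = t * m / v"
  define h where "h x = (1 - t * indicator A x) * g x + y * indicator (ball c R) x" for x
  have v: "v > 0" using R by (simp add: v_def content_ball_pos)
  have m: "m \<ge> 0" by (simp add: m_def)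
  have y: "y \<ge> 0" using t m v by (simp add: y_def)
  have \<nu>: "\<nu> = density lborel (\<lambda>x. ennreal (h x))"
    unfolding \<nu>_def \<rho>_def h_def y_def m_def v_def
    using t R by (intro distr_transfer g g0 prob[unfolded \<rho>_def] A) auto
  have \<nu>_prob: "prob_space \<nu>"
    unfolding \<nu>_def by (intro P.prob_space_distr measurable_transfer sets unif R A)
  have h [measurable]: "h \<in> borel_measurable borel" unfolding h_def by measurable
  have c: "0 \<le> 1 - t * indicator A x" "1 - t * indicator A x \<le> 1" for x
    using t by (auto simp: indicator_def)
  have h0: "0 \<le> h x" for x unfolding h_def using c g0 y by simp

  \<comment> \<open>The tangent of the logarithm at \<open>s\<close> replaces \<open>ln (g x + y)\<close> by an affine function of \<open>g x\<close>,
    whose integral over the ball only depends on the mass there.\<close>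
  define B where "B x = y * indicator (ball c R) x * (ln s + (g x + y) / s)" for x
  have U: "U_lin (h x) \<le> U_lin (g x) - t * (indicator A x * U_lin (g x)) + B x" for x
  proof -
    let ?k = "1 - t * indicator A x" and ?y = "y * indicator (ball c R) x"
    have "U_lin (h x) \<le> U_lin (?k * g x) + ?y * (ln s + (?k * g x + ?y) / s)"
      unfolding h_def using c g0 y s by (intro U_lin_add) auto
    also have "U_lin (?k * g x) \<le> ?k * U_lin (g x)" using c g0 by (intro U_lin_scale)
    also have "?y * (ln s + (?k * g x + ?y) / s) \<le> B x"
      unfolding B_def using y s c[of x] g0[of x]
      by (intro mult_left_mono add_left_mono divide_right_mono add_mono mult_left_le_one_le)
        (auto simp: indicator_def)
    finally show ?thesis by (simp add: algebra_simps)
  qed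
  have ig: "integrable lborel g" using prob_density_integral[OF prob[unfolded \<rho>_def] g g0] by simp
  have iA: "integrable lborel (\<lambda>x. indicator A x * U_lin (g x))"
    using integrable_mult_indicator[of A lborel "\<lambda>x. U_lin (g x)"] int by simp
  have iB1: "integrable lborel (\<lambda>x. indicator (ball c R) x :: real)"
    using emeasure_lborel_ball_finite[of c R] by simp
  have iB2: "integrable lborel (\<lambda>x. indicator (ball c R) x * g x)"
    using integrable_mult_indicator[of "ball c R" lborel g] ig by simp
  have B_eq: "B = (\<lambda>x. y * (ln s + y / s) * indicator (ball c R) x + y / s * (indicator (ball c R) x * g x))"
    using s by (auto simp: B_def fun_eq_iff field_simps)
  have "measure \<rho> (ball c R) = enn2real (\<integral>\<^sup>+x. ennreal (indicator (ball c R) x * g x) \<partial>lborel)"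
    unfolding \<rho>_def measure_def
    by (subst emeasure_density) (auto intro!: arg_cong[of _ _ enn2real] nn_integral_cong simp: indicator_def)
  also have "\<dots> = (\<integral>x. indicator (ball c R) x * g x \<partial>lborel)"
    using g0 by (subst integral_eq_nn_integral) auto
  finally have \<rho>B: "(\<integral>x. indicator (ball c R) x * g x \<partial>lborel) = measure \<rho> (ball c R)" ..
  have iB: "integrable lborel B" unfolding B_eq by (intro Bochner_Integration.integrable_add integrable_mult_right iB1 iB2)
  \<comment> \<open>The hypothesis on \<open>s\<close> bounds the mean density on the ball by
    \<open>s\<close>, even with all of its old mass counted. The correction to
    \<open>t * m * ln s\<close> is then at most \<open>y * v = t * m\<close>.\<close>
  have "(\<integral>x. B x \<partial>lborel) = y * (ln s + y / s) * v + y / s * measure \<rho> (ball c R)"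
    unfolding B_eq using iB1 iB2 by (simp add: \<rho>B v_def)
  also have "\<dots> = t * m * ln s + y / s * (measure \<rho> (ball c R) + t * m)"
    using v s by (simp add: y_def field_simps)
  also have "\<dots> \<le> t * m * ln s + y / s * (s * v)"
    using s(2) y s(1) by (intro add_left_mono mult_left_mono) (auto simp: m_def v_def)
  also have "\<dots> = t * m * (ln s + 1)" using s v by (simp add: y_def algebra_simps)
  finally have B_le: "(\<integral>x. B x \<partial>lborel) \<le> t * m * (ln s + 1)" .

  define I where "I = (\<integral>x. U_lin (g x) \<partial>lborel)"
  define IA where "IA = (\<integral>x. indicator A x * U_lin (g x) \<partial>lborel)"
  have IA: "IA = (\<integral>x\<in>A. U_lin (g x) \<partial>lborel)" by (simp add: IA_def set_lebesgue_integral_def)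
  have "internal_energy \<nu> = ext_integral lborel (\<lambda>x. ereal (U_lin (h x)))"
    unfolding \<nu> by (intro internal_energy_density h h0 \<nu>_prob[unfolded \<nu>])
  also have "\<dots> \<le> ereal (\<integral>x. U_lin (g x) - t * (indicator A x * U_lin (g x)) + B x \<partial>lborel)"
    by (intro ext_integral_le Bochner_Integration.integrable_add Bochner_Integration.integrable_diff integrable_mult_right int iA iB U)
      (simp add: U_lin_def)
  also have "(\<integral>x. U_lin (g x) - t * (indicator A x * U_lin (g x)) + B x \<partial>lborel) = I - t * IA + (\<integral>x. B x \<partial>lborel)"
    using int iA iB by (simp add: I_def IA_def)
  also have "\<dots> \<le> I - t * IA + t * m * (ln s + 1)" using B_le by simp
  finally have E\<nu>: "internal_energy \<nu> \<le> ereal (I - t * IA + t * m * (ln s + 1))" by simp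
  have E\<rho>: "internal_energy \<rho> = ereal I"
    unfolding \<rho>_def I_def
    by (simp add: internal_energy_density g g0 prob[unfolded \<rho>_def] ext_integral_integrable int)

  define J where "J = enn2real (interaction V \<rho>)"
  have J: "interaction V \<rho> = ennreal J" "J \<ge> 0" using fin by (auto simp: J_def V_def)
  have "interaction V \<nu> \<le> interaction V \<rho> + 2 * (ennreal (t * m) * ennreal K)"
  proof (rule interaction_perturbation[where \<eta> = "unif c R"])
    show "V \<in> borel_measurable borel" unfolding V_def using W(2) by measurable
    show "V (- x) = V x" for x using W(3)[of x] by (simp add: V_def)
    show "(\<integral>\<^sup>+x. V (x - y) \<partial>unif c R) \<le> ennreal K" for y unfolding V_def by (rule K)
    show "(\<integral>\<^sup>+x. f x \<partial>\<nu>) \<le> (\<integral>\<^sup>+x. f x \<partial>\<rho>) + ennreal (t * m) * (\<integral>\<^sup>+x. f x \<partial>unif c R)"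
      if "f \<in> borel_measurable borel" for f
      unfolding \<nu>_def m_def using t R that
      by (intro nn_integral_distr_transfer_le sets unif prob A) auto
  qed (use sets unif(1,2)[OF R] prob \<nu>_prob in \<open>simp_all add: \<nu>_def\<close>)
  also have "\<dots> = ennreal (J + 2 * (t * m * K))"
    using J t m \<open>K \<ge> 0\<close> by (simp add: ennreal_plus ennreal_mult')
  finally have J\<nu>: "enn2ereal (interaction V \<nu>) \<le> ereal (J + 2 * (t * m * K))"
    using J t m \<open>K \<ge> 0\<close> by (metis enn2ereal_ennreal less_eq_ennreal.rep_eq add_nonneg_nonneg mult_nonneg_nonneg less_imp_le zero_le_numeral)
  have "interaction_energy W \<nu> = ereal (1/2) * enn2ereal (interaction V \<nu>)"
    unfolding V_def by (rule interaction_energy_eq[OF W(1)])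
  also have "\<dots> \<le> ereal (1/2) * ereal (J + 2 * (t * m * K))"
    by (intro ereal_mult_left_mono J\<nu>) simp
  finally have W\<nu>: "interaction_energy W \<nu> \<le> ereal (J / 2 + t * m * K)"
    by (simp add: add_divide_distrib)
  have W\<rho>: "interaction_energy W \<rho> = ereal (J / 2)"
    using J by (simp add: interaction_energy_eq[OF W(1)] V_def[symmetric] enn2ereal_ennreal)
  have "energy W \<epsilon> \<nu> \<le> ereal (J / 2 + t * m * K) + ereal \<epsilon> * ereal (I - t * IA + t * m * (ln s + 1))"
    unfolding energy_def using \<open>\<epsilon> > 0\<close> by (intro add_mono W\<nu> ereal_mult_left_mono E\<nu>) simp
  also have "\<dots> = ereal (J / 2 + \<epsilon> * I + t * (m * (K + \<epsilon> * (ln s + 1)) - \<epsilon> * IA))"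
    by (simp add: algebra_simps)
  also have "\<dots> < ereal (J / 2 + \<epsilon> * I)"
    using t neg by (simp add: mult_pos_neg m_def IA)
  also have "\<dots> = energy W \<epsilon> \<rho>" by (simp add: energy_def W\<rho> E\<rho>)
  finally show ?thesis by (simp add: \<nu>_def)
qed

section \<open>Local minimizers\<close>

context coupling
begin

lemma wasserstein_bounded_displacement:
  assumes p: "1 \<le> p" and \<rho>: "\<rho> \<in> wasserstein_class p" and "D \<ge> 0"
    and AE: "AE z in \<rho> \<Otimes>\<^sub>M Q. norm (fst z - T z) \<le> D"
  shows "\<nu> \<in> wasserstein_class p \<and> wasserstein p \<rho> \<nu> \<le> ennreal D"
proof (cases "p = \<infinity>")
  case True
  then show ?thesis
    using wasserstein_class_infinity_target[OF _ AE] wasserstein_infinity_le[OF AE] \<rho> by simp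
next
  case False
  have q: "real_of_ereal p > 0" using p False by (cases p) auto
  have "(\<integral>\<^sup>+z. ennreal (norm (fst z - T z) powr real_of_ereal p) \<partial>(\<rho> \<Otimes>\<^sub>M Q))
      \<le> (\<integral>\<^sup>+z. ennreal (D powr real_of_ereal p) \<partial>(\<rho> \<Otimes>\<^sub>M Q))"
    using AE q by (intro nn_integral_mono_AE) (auto elim!: eventually_mono intro!: ennreal_leI powr_mono2)
  also have "\<dots> = ennreal (D powr real_of_ereal p)" by (simp add: P.emeasure_space_1)
  finally have le: "(\<integral>\<^sup>+z. ennreal (norm (fst z - T z) powr real_of_ereal p) \<partial>(\<rho> \<Otimes>\<^sub>M Q))
      \<le> ennreal (D powr real_of_ereal p)" .
  have "wasserstein p \<rho> \<nu> \<le> ennreal ((D powr real_of_ereal p) powr (1 / real_of_ereal p))"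
    by (rule wasserstein_le[OF p False _ le]) simp
  also have "(D powr real_of_ereal p) powr (1 / real_of_ereal p) = D"
    using q \<open>D \<ge> 0\<close> by (simp add: powr_powr)
  finally show ?thesis
    using wasserstein_class_target[OF p False \<rho>] le_less_trans[OF le ennreal_less_top] by simp
qed

end

text \<open>The constant depends on a density only through its height \<open>b\<close>; uniform
  measures on balls of one radius share it, wherever the ball lies.\<close>

lemma potential_bound_unif:
  fixes W :: "'a::euclidean_space \<Rightarrow> ereal"
  assumes positive: "\<And>x. 0 < W x" and loc_int: "locally_integrable W"
    and lsc: "lower_semicontinuous W"
    and bounded_away: "\<And>\<delta>::real. \<delta> > 0 \<Longrightarrow> Linfty_on (UNIV - ball 0 \<delta>) W" and "b \<ge> 0"
  obtains K where "K \<ge> 0" "\<And>g y. g \<in> borel_measurable borel \<Longrightarrow> (\<And>x. g x \<le> b) \<Longrightarrow>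
      prob_space (density lborel (\<lambda>x. ennreal (g x))) \<Longrightarrow>
      (\<integral>\<^sup>+x. e2ennreal (W (x - y)) \<partial>density lborel (\<lambda>x. ennreal (g x))) \<le> ennreal K"
proof -
  have [measurable]: "W \<in> borel_measurable borel" using loc_int by (simp add: locally_integrable_def)
  have "\<bar>W x\<bar> = W x" for x using positive[of x] by simp
  moreover have "(\<integral>\<^sup>+x\<in>cball 0 1. e2ennreal \<bar>W x\<bar> \<partial>lborel) < \<infinity>"
    using loc_int compact_cball unfolding locally_integrable_def by blast
  ultimately have fin: "(\<integral>\<^sup>+x\<in>cball 0 1. e2ennreal (W x) \<partial>lborel) < \<infinity>" by simp
  obtain M where M: "M \<ge> 0" "\<And>x. norm x > 1 \<Longrightarrow> W x \<le> ereal M"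
    by (rule Linfty_on_lower_semicontinuous_bound[OF lsc bounded_away[of 1]]) auto
  define K where "K = enn2real (ennreal b * (\<integral>\<^sup>+x\<in>cball 0 1. e2ennreal (W x) \<partial>lborel) + ennreal M)"
  have K: "ennreal K = ennreal b * (\<integral>\<^sup>+x\<in>cball 0 1. e2ennreal (W x) \<partial>lborel) + ennreal M"
    unfolding K_def using fin by (intro ennreal_enn2real) (simp add: ennreal_mult_less_top)
  show ?thesis
  proof
    show "K \<ge> 0" by (simp add: K_def)
    fix g :: "'a \<Rightarrow> real" and y
    assume [measurable]: "g \<in> borel_measurable borel" and b: "\<And>x. g x \<le> b"
      and prob: "prob_space (density lborel (\<lambda>x. ennreal (g x)))"
    show "(\<integral>\<^sup>+x. e2ennreal (W (x - y)) \<partial>density lborel (\<lambda>x. ennreal (g x))) \<le> ennreal K"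
      unfolding K
    proof (rule potential_bound)
      show "e2ennreal (W x) \<le> ennreal M" if "1 < norm x" for x
        using e2ennreal_mono[OF M(2)[OF that]] by simp
      show "(\<integral>\<^sup>+x. ennreal (g x) \<partial>lborel) \<le> 1"
        using prob_space.emeasure_space_1[OF prob] by (simp add: emeasure_density)
    qed (auto intro: ennreal_leI b)
  qed
qed

text \<open>A measure of infinite energy could be a local minimizer only if all its neighbours had
  infinite energy. Mollification at radius \<open>r / 2\<close> moves mass by at most
  \<open>r / 2\<close> and yields a neighbour with bounded density, hence finite energy.\<close>

lemma local_minimizer_finite_energy:
  fixes W :: "'a::euclidean_space \<Rightarrow> ereal"
  assumes positive: "\<And>x. 0 < W x" and loc_int: "locally_integrable W"
    and lsc: "lower_semicontinuous W"
    and bounded_away: "\<And>\<delta>::real. \<delta> > 0 \<Longrightarrow> Linfty_on (UNIV - ball 0 \<delta>) W"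
    and "\<epsilon> > 0" and p: "1 \<le> p" and min: "local_minimizer p W \<epsilon> \<rho>"
  shows "energy W \<epsilon> \<rho> < \<infinity>"
proof -
  from min obtain r where \<rho>: "\<rho> \<in> wasserstein_class p" and r: "r > 0"
    "\<And>\<nu>. \<nu> \<in> wasserstein_class p \<Longrightarrow> wasserstein p \<rho> \<nu> < ennreal r \<Longrightarrow> energy W \<epsilon> \<rho> \<le> energy W \<epsilon> \<nu>"
    unfolding local_minimizer_def by blast
  have bp: "\<rho> \<in> borel_prob" using \<rho> by (simp add: wasserstein_class_def)
  define \<delta> where "\<delta> = r / 2"
  have \<delta>: "\<delta> > 0" "\<delta> < r" using r by (auto simp: \<delta>_def)
  interpret M: prob_space \<rho> using bp by (simp add: borel_prob_def)
  interpret Q: prob_space "unif (0::'a) \<delta>" by (rule unif[OF \<delta>(1)])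
  have [measurable_cong]: "sets \<rho> = sets borel" using bp by (simp add: borel_prob_def)
  note [measurable_cong] = unif(2)[OF \<delta>(1)]
  define \<nu> where "\<nu> = distr (\<rho> \<Otimes>\<^sub>M unif 0 \<delta>) borel (\<lambda>z. fst z + snd z)"
  interpret C: coupling \<rho> "unif 0 \<delta>" "\<lambda>z. fst z + snd z" \<nu>
    by unfold_locales (auto simp: \<nu>_def borel_prob_def bp[unfolded borel_prob_def, simplified])
  have "AE z in \<rho> \<Otimes>\<^sub>M unif 0 \<delta>. norm (fst z - (fst z + snd z)) \<le> \<delta>"
    using unif(3)[OF \<delta>(1), of "0::'a"]
    by (intro C.P.AE_pair_measure) (auto elim!: eventually_mono)
  then have \<nu>: "\<nu> \<in> wasserstein_class p" "wasserstein p \<rho> \<nu> \<le> ennreal \<delta>"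
    using C.wasserstein_bounded_displacement[OF p \<rho>, of \<delta>] \<delta> by auto
  have "ennreal \<delta> < ennreal r" using \<delta> by (simp add: ennreal_lessI)
  with \<nu>(2) have "wasserstein p \<rho> \<nu> < ennreal r" by (rule le_less_trans)
  from r(2)[OF \<nu>(1) this] have le: "energy W \<epsilon> \<rho> \<le> energy W \<epsilon> \<nu>" .
  obtain g where g: "g \<in> borel_measurable borel" "\<And>x. 0 \<le> g x"
    "\<And>x. g x \<le> 1 / measure lborel (ball (0::'a) \<delta>)" "\<nu> = density lborel (\<lambda>x. ennreal (g x))"
    unfolding \<nu>_def by (rule mollification[OF bp \<delta>(1)]) blast
  have prob: "prob_space \<nu>" using C.target_borel_prob by (simp add: borel_prob_def)
  have "0 \<le> 1 / measure lborel (ball (0::'a) \<delta>)" by simp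
  from potential_bound_unif[OF positive loc_int lsc bounded_away this]
  obtain K where K: "\<And>g y. g \<in> borel_measurable borel \<Longrightarrow> (\<And>x. g x \<le> 1 / measure lborel (ball (0::'a) \<delta>)) \<Longrightarrow>
      prob_space (density lborel (\<lambda>x. ennreal (g x))) \<Longrightarrow>
      (\<integral>\<^sup>+x. e2ennreal (W (x - y)) \<partial>density lborel (\<lambda>x. ennreal (g x))) \<le> ennreal K" by metis
  have "energy W \<epsilon> \<nu> < \<infinity>"
    unfolding g(4)
    by (rule energy_bounded_density_finite[where K = K and b = "1 / measure lborel (ball (0::'a) \<delta>)"])
      (use positive g prob \<open>\<epsilon> > 0\<close> in \<open>auto intro: less_imp_le K\<close>)
  with le show ?thesis by (rule le_less_trans)
qed

text \<open>The mass outside large balls tends to 0, and an open unit ball centred at norm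
  \<open>n + 1\<close> avoids the closed ball of radius \<open>n\<close>.\<close>

lemma obtain_light_ball:
  fixes \<rho> :: "'a::euclidean_space measure"
  assumes "\<rho> \<in> borel_prob" and "\<sigma> > 0"
  obtains c where "measure \<rho> (ball c 1) \<le> \<sigma>"
proof -
  interpret prob_space \<rho> using assms by (simp add: borel_prob_def)
  have sets: "sets \<rho> = sets borel" using assms by (simp add: borel_prob_def)
  have "(\<lambda>n. measure \<rho> (- cball 0 (real n))) \<longlonglongrightarrow> measure \<rho> (\<Inter>n. - cball 0 (real n))"
    by (rule finite_Lim_measure_decseq) (auto simp: sets decseq_def)
  moreover have "(\<Inter>n. - cball (0::'a) (real n)) = {}"
  proof (rule equals0I)
    fix x :: 'a assume "x \<in> (\<Inter>n. - cball 0 (real n))"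
    moreover obtain n where "norm x \<le> real n" using real_arch_simple by blast
    ultimately show False by (auto dest: spec[of _ n])
  qed
  ultimately have "(\<lambda>n. measure \<rho> (- cball 0 (real n))) \<longlonglongrightarrow> 0" by simp
  from order_tendstoD(2)[OF this \<open>\<sigma> > 0\<close>] obtain n where n: "measure \<rho> (- cball 0 (real n)) < \<sigma>"
    by (auto simp: eventually_sequentially)
  obtain c :: 'a where c: "norm c = real n + 1"
    using vector_choose_size[of "real n + 1"] by auto
  have "x \<in> - cball 0 (real n)" if "x \<in> ball c 1" for x
    using that c norm_triangle_ineq2[of c x] by (simp add: dist_norm)
  then have "measure \<rho> (ball c 1) \<le> measure \<rho> (- cball 0 (real n))"
    by (intro finite_measure_mono) (auto simp: sets)
  with n show ?thesis by (intro that[of c]) simp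
qed

lemma no_local_minimizer:
  fixes W :: "'a::euclidean_space \<Rightarrow> ereal"
  assumes positive: "\<And>x. 0 < W x" and loc_int: "locally_integrable W"
    and lsc: "lower_semicontinuous W" and sym: "\<And>x. W x = W (- x)"
    and bounded_away: "\<And>\<delta>::real. \<delta> > 0 \<Longrightarrow> Linfty_on (UNIV - ball 0 \<delta>) W"
    and "\<epsilon> > 0" and p: "1 \<le> p"
  shows "\<not> local_minimizer p W \<epsilon> \<rho>"
proof
  assume min: "local_minimizer p W \<epsilon> \<rho>"
  from min obtain r where \<rho>: "\<rho> \<in> wasserstein_class p" and r: "r > 0"
    "\<And>\<nu>. \<nu> \<in> wasserstein_class p \<Longrightarrow> wasserstein p \<rho> \<nu> < ennreal r \<Longrightarrow> energy W \<epsilon> \<rho> \<le> energy W \<epsilon> \<nu>"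
    unfolding local_minimizer_def by blast
  have bp: "\<rho> \<in> borel_prob" using \<rho> by (simp add: wasserstein_class_def)
  interpret M: prob_space \<rho> using bp by (simp add: borel_prob_def)
  have sets [measurable_cong]: "sets \<rho> = sets borel" using bp by (simp add: borel_prob_def)
  have W0: "0 \<le> W x" for x using positive by (simp add: less_imp_le)
  have W [measurable]: "W \<in> borel_measurable borel" using loc_int by (simp add: locally_integrable_def)

  have fin: "energy W \<epsilon> \<rho> < \<infinity>"
    by (rule local_minimizer_finite_energy[OF positive loc_int lsc bounded_away \<open>\<epsilon> > 0\<close> p min])
  have "internal_energy \<rho> \<noteq> \<infinity>"
    using fin \<open>\<epsilon> > 0\<close> by (auto simp: energy_def)
  then have ac: "\<rho> \<in> borel_prob_ac" and int_fin: "internal_energy \<rho> < \<infinity>"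
    by (auto simp: internal_energy_def split: if_splits)
  have J: "interaction (\<lambda>x. e2ennreal (W x)) \<rho> < \<infinity>"
  proof (rule ccontr)
    assume "\<not> ?thesis"
    then have "interaction (\<lambda>x. e2ennreal (W x)) \<rho> = \<infinity>" by (simp add: less_top[symmetric])
    then have "interaction_energy W \<rho> = \<infinity>" by (simp add: interaction_energy_eq[OF W0] top_ennreal.rep_eq)
    with fin show False by (simp add: energy_def)
  qed
  obtain g where g [measurable]: "g \<in> borel_measurable borel" and g0: "\<And>x. 0 \<le> g x"
    and \<rho>_eq: "\<rho> = density lborel (\<lambda>x. ennreal (g x))"
    by (rule borel_prob_ac_density[OF ac]) blast
  have prob: "prob_space (density lborel (\<lambda>x. ennreal (g x)))" using M.prob_space_axioms by (simp add: \<rho>_eq)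
  \<comment> \<open>The first moment controls the negative part of the entropy density; finite
    internal energy then controls the positive part.\<close>
  have int: "integrable lborel (\<lambda>x. U_lin (g x))"
  proof (rule integrable_if_ext_integral_less_top)
    show "(\<integral>\<^sup>+x. ennreal (- U_lin (g x)) \<partial>lborel) < \<infinity>"
      using wasserstein_class_first_moment[OF p \<rho>] by (intro nn_integral_uminus_U_lin g g0) (simp add: \<rho>_eq)
    show "ext_integral lborel (\<lambda>x. ereal (U_lin (g x))) < \<infinity>"
      using int_fin internal_energy_density(2)[OF g g0 prob] by (simp add: \<rho>_eq)
  qed (simp add: U_lin_def)

  \<comment> \<open>The set \<open>A\<close> and the radius \<open>R\<close> are fixed first: they
    determine the mass, the entropy on \<open>A\<close> and the constant \<open>K\<close>, hence the
    required mean density \<open>s\<close>. The centre and the fraction \<open>t\<close> may then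
    depend on \<open>s\<close>.\<close>
  have descent: False
    if A: "A \<in> sets borel" "measure \<rho> A > 0" and R: "R > 0"
      and near: "\<And>s. s > 0 \<Longrightarrow> \<exists>t c. 0 < t \<and> t \<le> 1 \<and>
        measure \<rho> (ball c R) + t * measure \<rho> A \<le> s * measure lborel (ball c R) \<and>
        (let \<nu> = distr (\<rho> \<Otimes>\<^sub>M (measure_pmf (bernoulli_pmf t) \<Otimes>\<^sub>M unif c R)) borel (transfer A)
         in \<nu> \<in> wasserstein_class p \<and> wasserstein p \<rho> \<nu> < ennreal r)" for A R
  proof -
    have "0 \<le> 1 / measure lborel (ball (0::'a) R)" by simp
    from potential_bound_unif[OF positive loc_int lsc bounded_away this]
    obtain K where K: "K \<ge> 0" "\<And>g y. g \<in> borel_measurable borel \<Longrightarrow> (\<And>x. g x \<le> 1 / measure lborel (ball (0::'a) R)) \<Longrightarrow>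
        prob_space (density lborel (\<lambda>x. ennreal (g x))) \<Longrightarrow>
        (\<integral>\<^sup>+x. e2ennreal (W (x - y)) \<partial>density lborel (\<lambda>x. ennreal (g x))) \<le> ennreal K" by metis
    define m where "m = measure \<rho> A"
    define IA where "IA = (\<integral>x\<in>A. U_lin (g x) \<partial>lborel)"
    \<comment> \<open>The choice of \<open>s\<close> makes \<open>m (K + \<epsilon> (ln s + 1))\<close> equal to \<open>\<epsilon> (IA - m)\<close>.\<close>
    define s where "s = exp (IA / m - K / \<epsilon> - 2)"
    have m: "m > 0" using A by (simp add: m_def)
    have "m * (K + \<epsilon> * (ln s + 1)) = \<epsilon> * IA - \<epsilon> * m"
      using m \<open>\<epsilon> > 0\<close> by (simp add: s_def field_simps)
    then have neg: "m * (K + \<epsilon> * (ln s + 1)) < \<epsilon> * IA" using m \<open>\<epsilon> > 0\<close> by simp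
    obtain t c where t: "0 < t" "t \<le> 1"
      and s: "measure \<rho> (ball c R) + t * measure \<rho> A \<le> s * measure lborel (ball c R)"
      and \<nu>: "distr (\<rho> \<Otimes>\<^sub>M (measure_pmf (bernoulli_pmf t) \<Otimes>\<^sub>M unif c R)) borel (transfer A) \<in> wasserstein_class p"
        "wasserstein p \<rho> (distr (\<rho> \<Otimes>\<^sub>M (measure_pmf (bernoulli_pmf t) \<Otimes>\<^sub>M unif c R)) borel (transfer A)) < ennreal r"
      using near[of s] by (auto simp: s_def Let_def)
    have Kc: "(\<integral>\<^sup>+x. e2ennreal (W (x - y)) \<partial>unif c R) \<le> ennreal K" for y
      unfolding unif_def
      by (rule K(2)) (use unif(1)[OF R, of c] in \<open>auto simp: unif_def content_ball_0[of c] indicator_def\<close>)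
    have "energy W \<epsilon> (distr (\<rho> \<Otimes>\<^sub>M (measure_pmf (bernoulli_pmf t) \<Otimes>\<^sub>M unif c R)) borel (transfer A)) < energy W \<epsilon> \<rho>"
      unfolding \<rho>_eq
      by (rule energy_perturbation[where s = s and K = K])
        (use W0 W sym \<open>\<epsilon> > 0\<close> g g0 prob int J A t R s K(1) Kc neg in
          \<open>simp_all add: \<rho>_eq[symmetric] m_def IA_def s_def\<close>)
    with r(2)[OF \<nu>] show False by simp
  qed

  show False
  proof (cases "p = \<infinity>")
    case True
    define S where "S = msupport \<rho>"
    have S: "compact S" using \<rho> True by (simp add: wasserstein_class_def S_def)
    have null: "- S \<in> null_sets \<rho>" unfolding S_def by (rule emeasure_Compl_msupport[OF sets])
    have "S \<noteq> {}"
      using null M.emeasure_space_1 sets_eq_imp_space_eq[OF sets] by (auto simp: null_sets_def)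
    moreover obtain e :: 'a where e: "norm e = 1" using vector_choose_size[of 1] by auto
    moreover have "continuous_on S (\<lambda>x. x \<bullet> e)" by (intro continuous_intros)
    ultimately obtain x0 where x0: "x0 \<in> S" "\<And>x. x \<in> S \<Longrightarrow> x \<bullet> e \<le> x0 \<bullet> e"
      using continuous_attains_sup[OF S, of "\<lambda>x. x \<bullet> e"] by blast
    \<comment> \<open>A transferred point moves by at most \<open>3 * \<delta>\<close>: to
      \<open>x0\<close>, on to \<open>c\<close>, and then within
      \<open>ball c \<delta>\<close>.\<close>
    define \<delta> where "\<delta> = r / 4"
    have \<delta>: "\<delta> > 0" "3 * \<delta> < r" using r by (auto simp: \<delta>_def)
    \<comment> \<open>Every point of \<open>ball c \<delta>\<close> lies strictly beyond
      \<open>x0\<close> in the direction \<open>e\<close>, and \<open>x0\<close> is an extreme point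
      of the support in that direction; so the ball carries no mass.\<close>
    define c where "c = x0 + \<delta> *\<^sub>R e"
    have "x \<notin> S" if "x \<in> ball c \<delta>" for x
    proof
      assume "x \<in> S"
      have "(c - x) \<bullet> e \<le> norm (c - x)" using norm_cauchy_schwarz[of "c - x" e] e by simp
      also have "\<dots> < \<delta>" using that by (simp add: dist_norm)
      finally have "x0 \<bullet> e < x \<bullet> e"
        using e by (simp add: c_def inner_diff_left inner_add_left dot_square_norm)
      with x0(2)[OF \<open>x \<in> S\<close>] show False by simp
    qed
    then have "ball c \<delta> \<subseteq> - S" by blast
    then have \<rho>B: "measure \<rho> (ball c \<delta>) = 0"
      using null_sets_subset[OF null, of "ball c \<delta>"] by (auto simp: sets measure_def null_sets_def)
    have A: "measure \<rho> (ball x0 \<delta>) > 0"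
      using x0(1) \<delta> by (auto simp: S_def msupport_def M.emeasure_eq_measure)
    have v: "measure lborel (ball c \<delta>) > 0" using \<delta> by (simp add: content_ball_pos)
    show False
    proof (rule descent[of "ball x0 \<delta>" \<delta>])
      fix s :: real assume s: "s > 0"
      define t where "t = min 1 (s * measure lborel (ball c \<delta>))"
      have t: "0 < t" "t \<le> 1" "t \<le> s * measure lborel (ball c \<delta>)" using s v by (auto simp: t_def)
      have "t * measure \<rho> (ball x0 \<delta>) \<le> t * 1" using t by (intro mult_left_mono) auto
      then have le: "measure \<rho> (ball c \<delta>) + t * measure \<rho> (ball x0 \<delta>) \<le> s * measure lborel (ball c \<delta>)"
        using t(3) \<rho>B by linarith
      interpret N: prob_space "unif c \<delta>" by (rule unif[OF \<delta>(1)])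
      interpret C: prob_space "measure_pmf (bernoulli_pmf t)" by (rule prob_space_measure_pmf)
      interpret P: pair_prob_space "measure_pmf (bernoulli_pmf t)" "unif c \<delta>" ..
      note [measurable_cong] = unif(2)[OF \<delta>(1), of c]
      define \<nu> where "\<nu> = distr (\<rho> \<Otimes>\<^sub>M (measure_pmf (bernoulli_pmf t) \<Otimes>\<^sub>M unif c \<delta>)) borel (transfer (ball x0 \<delta>))"
      interpret T: coupling \<rho> "measure_pmf (bernoulli_pmf t) \<Otimes>\<^sub>M unif c \<delta>" "transfer (ball x0 \<delta>)" \<nu>
        by unfold_locales (auto simp: \<nu>_def sets intro!: measurable_transfer unif \<delta>)
      have "AE v in measure_pmf (bernoulli_pmf t) \<Otimes>\<^sub>M unif c \<delta>. snd v \<in> ball c \<delta>"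
        using unif(3)[OF \<delta>(1), of c] by (intro P.AE_pair_measure) auto
      then have "AE z in \<rho> \<Otimes>\<^sub>M (measure_pmf (bernoulli_pmf t) \<Otimes>\<^sub>M unif c \<delta>). snd (snd z) \<in> ball c \<delta>"
        by (intro T.P.AE_pair_measure) auto
      then have "AE z in \<rho> \<Otimes>\<^sub>M (measure_pmf (bernoulli_pmf t) \<Otimes>\<^sub>M unif c \<delta>).
          norm (fst z - transfer (ball x0 \<delta>) z) \<le> 3 * \<delta>"
      proof eventually_elim
        case (elim z)
        show ?case
        proof (cases "fst z \<in> ball x0 \<delta> \<and> fst (snd z)")
          case True
          have "dist x0 c = \<delta>" using \<delta> e by (simp add: c_def dist_norm)
          then have "dist (fst z) (snd (snd z)) \<le> 3 * \<delta>"
            using True elim dist_triangle[of "fst z" "snd (snd z)" x0] dist_triangle[of x0 "snd (snd z)" c]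
            by (simp add: dist_commute)
          then show ?thesis using True by (simp add: transfer_def dist_norm)
        next
          case False
          then show ?thesis using \<delta> by (auto simp: transfer_def)
        qed
      qed
      then have \<nu>: "\<nu> \<in> wasserstein_class p" "wasserstein p \<rho> \<nu> \<le> ennreal (3 * \<delta>)"
        using T.wasserstein_bounded_displacement[OF p \<rho>, of "3 * \<delta>"] \<delta> by auto
      have "ennreal (3 * \<delta>) < ennreal r" using \<delta> by (intro ennreal_lessI) auto
      with \<nu>(2) have "wasserstein p \<rho> \<nu> < ennreal r" by (rule le_less_trans)
      with t le \<nu>(1) show "\<exists>t ca. 0 < t \<and> t \<le> 1 \<and>
          measure \<rho> (ball ca \<delta>) + t * measure \<rho> (ball x0 \<delta>) \<le> s * measure lborel (ball ca \<delta>) \<and>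
          (let \<nu> = distr (\<rho> \<Otimes>\<^sub>M (measure_pmf (bernoulli_pmf t) \<Otimes>\<^sub>M unif ca \<delta>)) borel (transfer (ball x0 \<delta>))
           in \<nu> \<in> wasserstein_class p \<and> wasserstein p \<rho> \<nu> < ennreal r)"
        by (intro exI[of _ t] exI[of _ c]) (simp add: Let_def \<nu>_def)
    qed (use A \<delta> in auto)
  next
    case False
    define q where "q = real_of_ereal p"
    have q: "q > 0" using p False by (cases p) (auto simp: q_def)
    show False
    proof (rule descent[of UNIV 1])
      have \<rho>1: "measure \<rho> UNIV = 1" using M.prob_space sets_eq_imp_space_eq[OF sets] by simp
      then show "measure \<rho> UNIV > 0" by simp
      fix s :: real assume s: "s > 0"
      \<comment> \<open>Half of the mass allowed by the mean density \<open>s\<close>: one half is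
        left for the mass already in the ball, the other for the transferred mass.\<close>
      define \<sigma> where "\<sigma> = s * measure lborel (ball (0::'a) 1) / 2"
      have \<sigma>: "\<sigma> > 0" using s content_ball_pos[of 1 "0::'a"] by (simp add: \<sigma>_def)
      obtain c where c: "measure \<rho> (ball c 1) \<le> \<sigma>" by (rule obtain_light_ball[OF bp \<sigma>])
      have one: "(0::real) < 1" by simp
      interpret N: prob_space "unif c 1" by (rule unif[OF one])
      note [measurable_cong] = unif(2)[OF one, of c]
      define D where "D = norm c + 1"
      \<comment> \<open>The cost of sending all of \<open>\<rho>\<close> independently to the
        uniform measure on the ball. It depends on \<open>c\<close>, hence on \<open>s\<close>, but
        it is finite by the moment condition, and moving a fraction \<open>t\<close> costs
        \<open>t * C\<close>.\<close>
      define C where "C = (\<integral>\<^sup>+x. \<integral>\<^sup>+y. ennreal (norm (x - y) powr q) \<partial>unif c 1 \<partial>\<rho>)"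
      have "C \<le> (\<integral>\<^sup>+x. ennreal (2 powr q) * (ennreal (norm x powr q) + ennreal (D powr q)) \<partial>\<rho>)"
        unfolding C_def
      proof (rule nn_integral_mono)
        fix x
        have "(\<integral>\<^sup>+y. ennreal (norm (x - y) powr q) \<partial>unif c 1) \<le>
            (\<integral>\<^sup>+y. ennreal (2 powr q) * (ennreal (norm x powr q) + ennreal (D powr q)) \<partial>unif c 1)"
        proof (rule nn_integral_mono_AE)
          show "AE y in unif c 1. ennreal (norm (x - y) powr q) \<le>
              ennreal (2 powr q) * (ennreal (norm x powr q) + ennreal (D powr q))"
            using unif(3)[OF one, of c]
          proof eventually_elim
            case (elim y)
            have "norm y \<le> D" using elim norm_triangle_ineq2[of y c] by (simp add: D_def dist_norm norm_minus_commute)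
            then have "norm (x - y) \<le> 2 * max (norm x) D" using norm_triangle_ineq4[of x y] by simp
            then have "norm (x - y) powr q \<le> (2 * max (norm x) D) powr q" using q by (intro powr_mono2) auto
            also have "\<dots> = 2 powr q * max (norm x) D powr q" by (simp add: powr_mult)
            also have "max (norm x) D powr q \<le> norm x powr q + D powr q" by (simp add: max_def)
            finally have "ennreal (norm (x - y) powr q) \<le> ennreal (2 powr q * (norm x powr q + D powr q))"
              by (intro ennreal_leI) simp
            then show ?case by (simp add: ennreal_mult)
          qed
        qed
        then show "(\<integral>\<^sup>+y. ennreal (norm (x - y) powr q) \<partial>unif c 1) \<le>
            ennreal (2 powr q) * (ennreal (norm x powr q) + ennreal (D powr q))"
          by (simp add: N.emeasure_space_1)
      qed
      also have "\<dots> = ennreal (2 powr q) * ((\<integral>\<^sup>+x. ennreal (norm x powr q) \<partial>\<rho>) + ennreal (D powr q))"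
        by (simp add: nn_integral_cmult nn_integral_add M.emeasure_space_1)
      also have "\<dots> < \<infinity>"
        using \<rho> False by (simp add: wasserstein_class_def q_def ennreal_mult_less_top)
      finally have "C < \<infinity>" .
      define C' where "C' = enn2real C"
      have C': "C = ennreal C'" "C' \<ge> 0" using \<open>C < \<infinity>\<close> by (auto simp: C'_def)
      \<comment> \<open>The bound by \<open>\<sigma>\<close> respects the mass allowance and the
        last bound keeps the cost at most \<open>(r / 2) powr q\<close>; adding 1 to
        \<open>C'\<close> avoids division by 0.\<close>
      define t where "t = min 1 (min \<sigma> ((r / 2) powr q / (C' + 1)))"
      have t: "0 < t" "t \<le> 1" "t \<le> \<sigma>" using \<sigma> r C' by (auto simp: t_def)
      have "t * C' \<le> (r / 2) powr q / (C' + 1) * (C' + 1)"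
        using t C' by (intro mult_mono) (auto simp: t_def)
      then have tC: "t * C' \<le> (r / 2) powr q" using C' by simp
      interpret B: prob_space "measure_pmf (bernoulli_pmf t)" by (rule prob_space_measure_pmf)
      interpret P: pair_prob_space "measure_pmf (bernoulli_pmf t)" "unif c 1" ..
      define \<nu> where "\<nu> = distr (\<rho> \<Otimes>\<^sub>M (measure_pmf (bernoulli_pmf t) \<Otimes>\<^sub>M unif c 1)) borel (transfer UNIV)"
      interpret T: coupling \<rho> "measure_pmf (bernoulli_pmf t) \<Otimes>\<^sub>M unif c 1" "transfer UNIV" \<nu>
        by unfold_locales (auto simp: \<nu>_def sets intro!: measurable_transfer unif)
      have "(\<integral>\<^sup>+z. ennreal (norm (fst z - transfer UNIV z) powr q) \<partial>(\<rho> \<Otimes>\<^sub>M (measure_pmf (bernoulli_pmf t) \<Otimes>\<^sub>M unif c 1)))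
          = (\<integral>\<^sup>+x. ennreal (1 - t * indicator UNIV x) * ennreal (norm (x - x) powr q) +
              ennreal (t * indicator UNIV x) * (\<integral>\<^sup>+y. ennreal (norm (x - y) powr q) \<partial>unif c 1) \<partial>\<rho>)"
        using t by (intro nn_integral_transfer[where F = "\<lambda>x y. ennreal (norm (x - y) powr q)"] sets unif) auto
      also have "\<dots> = ennreal t * C" by (simp add: C_def nn_integral_cmult)
      also have "\<dots> = ennreal (t * C')" using t C' by (simp add: ennreal_mult')
      also have "\<dots> \<le> ennreal ((r / 2) powr q)" by (intro ennreal_leI tC)
      finally have cost: "(\<integral>\<^sup>+z. ennreal (norm (fst z - transfer UNIV z) powr q) \<partial>(\<rho> \<Otimes>\<^sub>M (measure_pmf (bernoulli_pmf t) \<Otimes>\<^sub>M unif c 1)))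
          \<le> ennreal ((r / 2) powr q)" .
      have \<nu>: "\<nu> \<in> wasserstein_class p"
        using T.wasserstein_class_target[OF p False \<rho>] le_less_trans[OF cost ennreal_less_top] by (simp add: q_def)
      have "wasserstein p \<rho> \<nu> \<le> ennreal (((r / 2) powr q) powr (1 / q))"
        unfolding q_def by (rule T.wasserstein_le[OF p False _ cost[unfolded q_def]]) simp
      also have "((r / 2) powr q) powr (1 / q) = r / 2" using q r by (simp add: powr_powr)
      also have "ennreal (r / 2) < ennreal r" using r by (intro ennreal_lessI) auto
      finally have W\<nu>: "wasserstein p \<rho> \<nu> < ennreal r" .
      have "measure \<rho> (ball c 1) + t * measure \<rho> UNIV \<le> s * measure lborel (ball c 1)"
        using c t by (simp add: \<rho>1 \<sigma>_def content_ball_0[of c])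
      with t \<nu> W\<nu> show "\<exists>t c. 0 < t \<and> t \<le> 1 \<and>
          measure \<rho> (ball c 1) + t * measure \<rho> UNIV \<le> s * measure lborel (ball c 1) \<and>
          (let \<nu> = distr (\<rho> \<Otimes>\<^sub>M (measure_pmf (bernoulli_pmf t) \<Otimes>\<^sub>M unif c 1)) borel (transfer UNIV)
           in \<nu> \<in> wasserstein_class p \<and> wasserstein p \<rho> \<nu> < ennreal r)"
        by (intro exI[of _ t] exI[of _ c]) (simp add: Let_def \<nu>_def)
    qed auto
  qed
qed

theorem theorem3p1:
  fixes W :: "real ^ 'n \<Rightarrow> ereal"
  assumes positive: "\<And>x. 0 < W x"
    and loc_int: "locally_integrable W"
    and lsc: "lower_semicontinuous W"
    and symmetric: "\<And>x. W x = W (- x)"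
    and bounded_away: "\<And>\<delta>::real. \<delta> > 0 \<Longrightarrow> Linfty_on (UNIV - ball 0 \<delta>) W"
  shows "\<forall>\<epsilon>::real. \<epsilon> > 0 \<longrightarrow>
      (\<forall>p::ereal. 1 \<le> p \<longrightarrow> \<not> (\<exists>\<rho>. local_minimizer p W \<epsilon> \<rho>)) \<and>
      ((\<exists>w L. (\<forall>x. W x = ereal (w x)) \<and> L-lipschitz_on UNIV w) \<longrightarrow>
         \<not> (\<exists>\<rho>\<in>borel_prob_ac. critical_point W \<epsilon> \<rho>))"
proof (intro allI impI conjI)
  fix \<epsilon> :: real assume \<epsilon>: "\<epsilon> > 0"
  show "\<not> (\<exists>\<rho>. local_minimizer p W \<epsilon> \<rho>)" if "1 \<le> p" for p
    using no_local_minimizer[OF positive loc_int lsc symmetric bounded_away \<epsilon> that] by blast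
  assume "\<exists>w L. (\<forall>x. W x = ereal (w x)) \<and> L-lipschitz_on UNIV w"
  then obtain w L where w: "\<And>x. W x = ereal (w x)" and L: "L-lipschitz_on UNIV w" by blast
  \<comment> \<open>A Lipschitz kernel is bounded everywhere: outside the unit ball by
    \<open>M\<close>, inside it by the value at 0 plus \<open>L\<close>.\<close>
  obtain M where M: "M \<ge> 0" "\<And>x. norm x > 1 \<Longrightarrow> W x \<le> ereal M"
    by (rule Linfty_on_lower_semicontinuous_bound[OF lsc bounded_away[of 1]]) auto
  have "L \<ge> 0" using L by (simp add: lipschitz_on_def)
  have "0 \<le> w x" for x using positive[of x] by (simp add: w)
  moreover have "w x \<le> max M (w 0 + L)" for x
  proof (cases "norm x > 1")
    case True
    then show ?thesis using M(2)[of x] by (simp add: w)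
  next
    case False
    have "dist (w x) (w 0) \<le> L * dist x 0" by (rule lipschitz_onD[OF L]) auto
    also have "\<dots> \<le> L * 1" using False \<open>L \<ge> 0\<close> by (intro mult_left_mono) auto
    finally show ?thesis by (simp add: dist_real_def)
  qed
  moreover have "W = (\<lambda>x. ereal (w x))" by (simp add: w fun_eq_iff)
  ultimately show "\<not> (\<exists>\<rho>\<in>borel_prob_ac. critical_point W \<epsilon> \<rho>)"
    using no_critical_point[OF _ \<epsilon> _ _ L] by auto
qed

end
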